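(* Let $g$ be a hyperbolic drawing, restricted to an interval $I\subset\mathbb R$ that is bounded below. Then there exist a reparameterization $g\circ s$ of $g$ (with $s:V\to I$ an increasing smooth homeomorphism from an interval $V$ onto $I$) such that $g\circ s$ is smooth, and a smooth positive function $m$ on $V$, such that the plane wave $$G=2\,dU\,dv-m(u)^{-2}g_{ij}(s(u))\,dx^i\,dx^j,\qquad dU=\frac{du}{m(u)^2},$$ on $V\times\mathbb R\times\mathbb R^2$ (with coordinates $(u,v,x)$) is vacuum.
   Context: The hyperbolic plane $\mathbb H$ is modelled as the set of real symmetric positive-definite $2\times2$ matrices with determinant $1$. Its Riemannian metric is the pullback to this surface of the quadratic form $\det$ on the space of real symmetric $2\times 2$ matrices, taken with the sign making it positive definite: a tangent vector $\dot g$ has squared length $-\det\dot g$. The group $SL(2,\mathbb R)$ acts isometrically by $g\mapsto AgA^T$. A horocycle is an orbit in $\mathbb H$ of a unipotent one-parameter subgroup, equivalently the intersection of $\mathbb H$ with a null plane not through the origin. A hyperbolic drawing is a continuous function $f:\mathbb R\to\mathbb H$ such that, for every $n\in\mathbb Z$, $f|_{[n,n+1]}$ is a segment of a geodesic or of a horocycle parameterized by hyperbolic arc length. The entries of the matrix $g(u)\in\mathbb H$ are denoted $g_{ij}(u)$, $i,j\in\{1,2\}$. A metric is vacuum if its Ricci tensor vanishes. *)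

theory Defs
  imports "HOL-Analysis.Analysis"
begin

text \<open>
  Derivatives are taken within \<open>V\<close>, so they are one-sided at the endpoints that belong to \<open>V\<close>.
  Only meaningful if \<open>V\<close> has no isolated points.
\<close>

definition smooth_on :: "real set \<Rightarrow> (real \<Rightarrow> 'a::real_normed_vector) \<Rightarrow> bool" where
  "smooth_on V f \<longleftrightarrow> (\<exists>D :: nat \<Rightarrow> real \<Rightarrow> 'a.
     (\<forall>u\<in>V. D 0 u = f u) \<and>
     (\<forall>k. \<forall>u\<in>V. (D k has_vector_derivative D (Suc k) u) (at u within V)))"

text \<open>
  A metric on a coordinate domain \<open>M\<close> is given by its matrix of coefficients at each point.
  Derivatives are taken within \<open>M\<close>, so that \<open>M\<close> may also have a boundary, as a product
  of intervals does.
\<close>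

definition partial :: "(real^'n) set \<Rightarrow> 'n::finite \<Rightarrow> (real^'n \<Rightarrow> 'a::real_normed_vector)
    \<Rightarrow> real^'n \<Rightarrow> 'a" where
  "partial M i F p = frechet_derivative F (at p within M) (axis i 1)"

text \<open>\<open>christoffel M G p k i j\<close> is $\Gamma^k_{ij}(p)$.\<close>

definition christoffel :: "(real^'n) set \<Rightarrow> (real^'n \<Rightarrow> real^'n^'n) \<Rightarrow> real^'n
    \<Rightarrow> 'n::finite \<Rightarrow> 'n \<Rightarrow> 'n \<Rightarrow> real" where
  "christoffel M G p k i j = (1/2) * (\<Sum>l\<in>UNIV. matrix_inv (G p) $ k $ l *
     (partial M i (\<lambda>q. G q $ j $ l) p + partial M j (\<lambda>q. G q $ i $ l) p
      - partial M l (\<lambda>q. G q $ i $ j) p))"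

text \<open>\<open>riemann M G p i j k l\<close> is $R^i{}_{jkl}(p)$.\<close>

definition riemann :: "(real^'n) set \<Rightarrow> (real^'n \<Rightarrow> real^'n^'n) \<Rightarrow> real^'n
    \<Rightarrow> 'n::finite \<Rightarrow> 'n \<Rightarrow> 'n \<Rightarrow> 'n \<Rightarrow> real" where
  "riemann M G p i j k l =
     partial M k (\<lambda>q. christoffel M G q i l j) p - partial M l (\<lambda>q. christoffel M G q i k j) p
     + (\<Sum>r\<in>UNIV. christoffel M G p i k r * christoffel M G p r l j
               - christoffel M G p i l r * christoffel M G p r k j)"

definition ricci :: "(real^'n) set \<Rightarrow> (real^'n \<Rightarrow> real^'n^'n) \<Rightarrow> real^'n
    \<Rightarrow> 'n::finite \<Rightarrow> 'n \<Rightarrow> real" where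
  "ricci M G p j l = (\<Sum>i\<in>UNIV. riemann M G p i j i l)"

definition vacuum :: "(real^'n::finite) set \<Rightarrow> (real^'n \<Rightarrow> real^'n^'n) \<Rightarrow> bool" where
  "vacuum M G \<longleftrightarrow> (\<forall>p\<in>M. \<forall>j l. ricci M G p j l = 0)"

definition geodesic :: "(real^'n::finite) set \<Rightarrow> (real^'n \<Rightarrow> real^'n^'n) \<Rightarrow> (real \<Rightarrow> real^'n) \<Rightarrow> bool"
  where
  "geodesic M G x \<longleftrightarrow> range x \<subseteq> M \<and> (\<exists>x' x''.
     (\<forall>t. (x has_vector_derivative x' t) (at t)) \<and>
     (\<forall>t. (x' has_vector_derivative x'' t) (at t)) \<and>
     (\<forall>t k. x'' t $ k + (\<Sum>i\<in>UNIV. \<Sum>j\<in>UNIV. christoffel M G (x t) k i j * x' t $ i * x' t $ j) = 0))"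

definition hyperbolic_plane :: "(real^2^2) set" where
  "hyperbolic_plane = {A. transpose A = A \<and> (\<forall>x. x \<noteq> 0 \<longrightarrow> x \<bullet> (A *v x) > 0) \<and> det A = 1}"

text \<open>The symmetric bilinear form whose quadratic form is \<open>-det\<close>.\<close>

definition hyp_form :: "real^2^2 \<Rightarrow> real^2^2 \<Rightarrow> real" where
  "hyp_form X Y = - (det (X + Y) - det X - det Y) / 2"

text \<open>
  The first-row entries \<open>(g\<^sub>1\<^sub>1, g\<^sub>1\<^sub>2)\<close> are global coordinates on the hyperbolic plane, with range
  the half-plane \<open>g\<^sub>1\<^sub>1 > 0\<close>. \<open>hyp_param\<close> is the inverse of this chart, and \<open>hyp_metric\<close> is the
  pullback of \<open>-det\<close> to the surface, expressed in this chart.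
\<close>

definition hyp_dom :: "(real^2) set" where
  "hyp_dom = {p. p $ 1 > 0}"

definition hyp_param :: "real^2 \<Rightarrow> real^2^2" where
  "hyp_param p = vector [vector [p $ 1, p $ 2], vector [p $ 2, (1 + (p $ 2)\<^sup>2) / p $ 1]]"

definition hyp_metric :: "real^2 \<Rightarrow> real^2^2" where
  "hyp_metric p = (\<chi> i j. hyp_form (partial hyp_dom i hyp_param p) (partial hyp_dom j hyp_param p))"

definition hyp_geodesic :: "(real \<Rightarrow> real^2^2) \<Rightarrow> bool" where
  "hyp_geodesic c \<longleftrightarrow> range c \<subseteq> hyperbolic_plane \<and> geodesic hyp_dom hyp_metric (\<lambda>t. c t $ 1)"

definition unipotent :: "real^'n^'n \<Rightarrow> bool" where
  "unipotent A \<longleftrightarrow> (\<exists>k. (((**) (A - mat 1)) ^^ k) (mat 1) = 0)"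

definition unipotent_subgroup :: "(real \<Rightarrow> real^2^2) \<Rightarrow> bool" where
  "unipotent_subgroup U \<longleftrightarrow> continuous_on UNIV U \<and> (\<forall>t. det (U t) = 1 \<and> unipotent (U t)) \<and>
     (\<forall>s t. U (s + t) = U s ** U t) \<and> (\<exists>t. U t \<noteq> mat 1)"

definition horocycle :: "(real^2^2) set \<Rightarrow> bool" where
  "horocycle h \<longleftrightarrow> (\<exists>U. \<exists>A\<in>hyperbolic_plane. unipotent_subgroup U \<and>
     h = range (\<lambda>t. U t ** A ** transpose (U t)))"

definition arc_length_param :: "(real \<Rightarrow> real^2^2) \<Rightarrow> bool" where
  "arc_length_param c \<longleftrightarrow> range c \<subseteq> hyperbolic_plane \<and> (\<exists>c'. continuous_on UNIV c' \<and>
     (\<forall>t. (c has_vector_derivative c' t) (at t) \<and> - det (c' t) = 1))"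

text \<open>
  The hyperbolic plane is complete, so a geodesic or horocycle segment parameterized by
  arc length is the restriction of such a curve \<open>c\<close> that is defined on the whole line.
\<close>

definition hyperbolic_drawing :: "(real \<Rightarrow> real^2^2) \<Rightarrow> bool" where
  "hyperbolic_drawing f \<longleftrightarrow> range f \<subseteq> hyperbolic_plane \<and> continuous_on UNIV f \<and>
     (\<forall>n::int. \<exists>c. arc_length_param c \<and> (hyp_geodesic c \<or> (\<exists>h. horocycle h \<and> range c \<subseteq> h)) \<and>
        (\<forall>u\<in>{of_int n .. of_int n + 1}. f u = c u))"

text \<open>
  The metric $2\,dU\,dv - m(u)^{-2} g_{ij}(u)\,dx^i\,dx^j$ with $dU = m(u)^{-2} du$, in the
  coordinates \<open>(u, v, x\<^sup>1, x\<^sup>2)\<close>. The coefficient of \<open>du dv\<close> in the line element is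
  twice the matrix entry.
\<close>

definition plane_wave :: "(real \<Rightarrow> real^2^2) \<Rightarrow> (real \<Rightarrow> real) \<Rightarrow> real^4 \<Rightarrow> real^4^4" where
  "plane_wave g m p = (let u = p $ 1; w = 1 / (m u)\<^sup>2 in vector
     [vector [0, w, 0, 0],
      vector [w, 0, 0, 0],
      vector [0, 0, - w * g u $ 1 $ 1, - w * g u $ 1 $ 2],
      vector [0, 0, - w * g u $ 2 $ 1, - w * g u $ 2 $ 2]])"

end

theory Submission
  imports Defs "HOL-Real_Asymp.Real_Asymp"
begin

text \<open>
  Reparameterize by a smooth homeomorphism \<open>s\<close> of the line that fixes the integers and all of whose
  derivatives vanish there. On each unit interval the drawing \<open>g\<close> is the restriction of a smooth
  curve \<open>c\<close>: a geodesic satisfies $c'' = c$ in the space of symmetric matrices, and a horocycle is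
  a quadratic curve on which an arc length parameter is affine. Hence \<open>g \<circ> s\<close> is smooth, all its
  derivatives vanishing at the integers. With $h = g \circ s$ the only component of the Ricci tensor
  that is not identically zero is the one along \<open>u\<close>, and it vanishes if and only if
  $m'' = -\frac14 (\det h')\, m = \frac14 (s')^2 m$. As the coefficient is nonnegative, the solution
  with $m = 1$ and $m' = 0$ at the origin is at least 1 on the whole line.
\<close>

text \<open>Neighbouring segments of a drawing in general meet with different velocities. A
  reparameterization makes their join smooth by forcing every derivative to 0 from both sides, so
  flatness is carried along with smoothness. Because \<open>det h = 1\<close> is constant, the shape
  of the curve drops out of the vacuum equation and only the determinant of \<open>h'\<close>, that
  is, the hyperbolic speed, remains. Arc length on each piece makes this speed equal to the
  derivative of \<open>s\<close>, so the equation for \<open>m\<close> is the same for every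
  drawing, and its coefficient is smooth and bounded although the pieces change at the integers. For
  \<open>w = m^(-2)\<close> and \<open>r = - m'/m\<close> one has \<open>w' = 2 r w\<close>, and the
  vacuum condition is the Riccati equation \<open>r' = r^2 - (s')^2/4\<close>; the choice of
  \<open>m\<close> as unknown linearizes it. All objects are built on the whole line and then
  restricted to the preimage \<open>V\<close> of \<open>I\<close>. Endpoints of \<open>V\<close>
  matter only in showing that derivatives within the slab over \<open>V\<close> agree with the
  two-sided ones.\<close>

section \<open>Smooth functions that are flat on a set\<close>

text \<open>With \<open>Z = {}\<close> this is smoothness on the line.\<close>

definition smooth_flat :: "real set \<Rightarrow> (real \<Rightarrow> 'a::real_normed_vector) \<Rightarrow> bool" where
  "smooth_flat Z f \<longleftrightarrow> (\<exists>D :: nat \<Rightarrow> real \<Rightarrow> 'a. D 0 = f \<and>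
     (\<forall>k u. (D k has_vector_derivative D (Suc k) u) (at u)) \<and>
     (\<forall>k. \<forall>u\<in>Z. D (Suc k) u = 0))"

lemma smooth_flatE:
  assumes "smooth_flat Z f"
  obtains f' where "\<And>u. (f has_vector_derivative f' u) (at u)" "\<And>u. u \<in> Z \<Longrightarrow> f' u = 0"
    "smooth_flat Z f'"
proof -
  obtain D where D: "D 0 = f" "\<And>k u. (D k has_vector_derivative D (Suc k) u) (at u)"
    "\<And>k u. u \<in> Z \<Longrightarrow> D (Suc k) u = 0"
    using assms unfolding smooth_flat_def by blast
  have "smooth_flat Z (D (Suc 0))"
    unfolding smooth_flat_def by (rule exI[of _ "\<lambda>k. D (Suc k)"]) (use D in auto)
  with D that[of "D (Suc 0)"] show ?thesis by metis
qed

text \<open>Choosing for each function of the class a derivative inside the class and iterating the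
  choice yields the whole tower of derivatives. Smoothness proofs thus need one differentiation and
  no formula for higher derivatives.\<close>

lemma smooth_flat_coinduct:
  assumes "P f" and step: "\<And>f. P f \<Longrightarrow> \<exists>f'. P f' \<and>
      (\<forall>u. (f has_vector_derivative f' u) (at u)) \<and> (\<forall>u\<in>Z. f' u = 0)"
  shows "smooth_flat Z f"
proof -
  obtain d where d: "\<And>f. P f \<Longrightarrow> P (d f) \<and>
      (\<forall>u. (f has_vector_derivative d f u) (at u)) \<and> (\<forall>u\<in>Z. d f u = 0)"
    using step by metis
  define D where "D k = (d ^^ k) f" for k
  have "P (D k)" for k
    by (induction k) (use d \<open>P f\<close> in \<open>auto simp: D_def\<close>)
  then show ?thesis
    unfolding smooth_flat_def by (intro exI[of _ D]) (use d in \<open>auto simp: D_def\<close>)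
qed

text \<open>The product and chain rules lead from a product to a sum of products. Closing a class
  under finite sums lets coinduction work with the single products.\<close>

inductive finite_sum :: "((real \<Rightarrow> 'a::real_normed_vector) \<Rightarrow> bool) \<Rightarrow> (real \<Rightarrow> 'a) \<Rightarrow> bool"
  for P where
  base: "P f \<Longrightarrow> finite_sum P f"
| add: "finite_sum P f \<Longrightarrow> finite_sum P g \<Longrightarrow> finite_sum P (\<lambda>u. f u + g u)"

lemma smooth_flat_coinduct_sum:
  assumes "finite_sum P f" and step: "\<And>f. P f \<Longrightarrow> \<exists>f'. finite_sum P f' \<and>
      (\<forall>u. (f has_vector_derivative f' u) (at u)) \<and> (\<forall>u\<in>Z. f' u = 0)"
  shows "smooth_flat Z f"
proof (rule smooth_flat_coinduct[of "finite_sum P", OF assms(1)])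
  fix f :: "real \<Rightarrow> 'a" assume "finite_sum P f"
  then show "\<exists>f'. finite_sum P f' \<and> (\<forall>u. (f has_vector_derivative f' u) (at u)) \<and> (\<forall>u\<in>Z. f' u = 0)"
  proof induction
    case (base f)
    then show ?case by (rule step)
  next
    case (add f g)
    then obtain f' g' where
      "finite_sum P f'" "\<forall>u. (f has_vector_derivative f' u) (at u)" "\<forall>u\<in>Z. f' u = 0"
      "finite_sum P g'" "\<forall>u. (g has_vector_derivative g' u) (at u)" "\<forall>u\<in>Z. g' u = 0"
      by blast
    then show ?case
      by (intro exI[of _ "\<lambda>u. f' u + g' u"])
        (auto intro: finite_sum.add has_vector_derivative_add)
  qed
qed

lemma smooth_flat_mono: "smooth_flat Z f \<Longrightarrow> Y \<subseteq> Z \<Longrightarrow> smooth_flat Y f"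
  unfolding smooth_flat_def by blast

lemma smooth_flat_imp_smooth_on: "smooth_flat Z f \<Longrightarrow> smooth_on V f"
  unfolding smooth_flat_def smooth_on_def
  by (metis has_vector_derivative_at_within)

lemma smooth_flat_of_deriv:
  assumes "\<And>u. (f has_vector_derivative f' u) (at u)" "\<And>u. u \<in> Z \<Longrightarrow> f' u = 0"
    "smooth_flat Z f'"
  shows "smooth_flat Z f"
proof -
  obtain D where D: "D 0 = f'" "\<And>k u. (D k has_vector_derivative D (Suc k) u) (at u)"
    "\<And>k u. u \<in> Z \<Longrightarrow> D (Suc k) u = 0"
    using assms(3) unfolding smooth_flat_def by blast
  then have "D k u = 0" if "u \<in> Z" for k u
    using assms(2) that by (cases k) auto
  with D assms(1) show ?thesis
    unfolding smooth_flat_def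
    by (intro exI[of _ "case_nat f D"]) (auto split: nat.split)
qed

lemma smooth_flat_const: "smooth_flat Z (\<lambda>_. c)"
  unfolding smooth_flat_def by (rule exI[of _ "case_nat (\<lambda>_. c) (\<lambda>_ _. 0)"]) (auto split: nat.split)

lemma smooth_flat_add:
  assumes "smooth_flat Z f" "smooth_flat Z g"
  shows "smooth_flat Z (\<lambda>u. f u + g u)"
proof (rule smooth_flat_coinduct_sum[where P = "smooth_flat Z"])
  show "finite_sum (smooth_flat Z) (\<lambda>u. f u + g u)"
    using assms by (intro finite_sum.add finite_sum.base)
qed (meson smooth_flatE finite_sum.base)

lemma has_vector_derivative_scaleR_fun:
  assumes "(f has_vector_derivative f') (at u)" "(g has_vector_derivative g') (at u)"
  shows "((\<lambda>u. f u *\<^sub>R g u) has_vector_derivative (f' *\<^sub>R g u + f u *\<^sub>R g')) (at u)"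
  using has_vector_derivative_scaleR[of f f' "u" UNIV g g'] assms
  by (simp add: has_real_derivative_iff_has_vector_derivative add.commute)

lemma smooth_flat_scaleR:
  fixes g :: "real \<Rightarrow> 'a::real_normed_vector"
  assumes "smooth_flat Z f" "smooth_flat Z g"
  shows "smooth_flat Z (\<lambda>u. f u *\<^sub>R g u)"
proof (rule smooth_flat_coinduct_sum[where P = "\<lambda>h :: real \<Rightarrow> 'a. \<exists>f g. smooth_flat Z f \<and> smooth_flat Z g \<and>
    h = (\<lambda>u. f u *\<^sub>R g u)", OF finite_sum.base], goal_cases)
  case 1
  show ?case using assms by blast
next
  case (2 h)
  then obtain f and g :: "real \<Rightarrow> 'a" where fg: "smooth_flat Z f" "smooth_flat Z g" "h = (\<lambda>u. f u *\<^sub>R g u)" by blast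
  from fg(1) obtain f' where f': "\<And>u. (f has_vector_derivative f' u) (at u)"
    "\<And>u. u \<in> Z \<Longrightarrow> f' u = 0" "smooth_flat Z f'" by (rule smooth_flatE) blast
  from fg(2) obtain g' where g': "\<And>u. (g has_vector_derivative g' u) (at u)"
    "\<And>u. u \<in> Z \<Longrightarrow> g' u = 0" "smooth_flat Z g'" by (rule smooth_flatE) blast
  let ?P = "\<lambda>h. \<exists>f g. smooth_flat Z f \<and> smooth_flat Z g \<and> h = (\<lambda>u. f u *\<^sub>R g u)"
  have "?P (\<lambda>u. f' u *\<^sub>R g u)" "?P (\<lambda>u. f u *\<^sub>R g' u)" using fg f' g' by blast+
  then have "finite_sum ?P (\<lambda>u. f' u *\<^sub>R g u + f u *\<^sub>R g' u)"
    by (intro finite_sum.intros)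
  moreover have "(h has_vector_derivative f' u *\<^sub>R g u + f u *\<^sub>R g' u) (at u)" for u
    unfolding fg(3) using f'(1) g'(1) by (rule has_vector_derivative_scaleR_fun)
  moreover have "f' u *\<^sub>R g u + f u *\<^sub>R g' u = 0" if "u \<in> Z" for u
    using that f' g' by simp
  ultimately show ?case by blast
qed

lemma smooth_flat_mult:
  fixes f g :: "real \<Rightarrow> real"
  shows "smooth_flat Z f \<Longrightarrow> smooth_flat Z g \<Longrightarrow> smooth_flat Z (\<lambda>u. f u * g u)"
  using smooth_flat_scaleR[of Z f g] by simp

lemma has_vector_derivative_compose:
  fixes s :: "real \<Rightarrow> real"
  assumes "(s has_vector_derivative s') (at u)" "(f has_vector_derivative f') (at (s u))"
  shows "((\<lambda>u. f (s u)) has_vector_derivative (s' *\<^sub>R f')) (at u)"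
  using vector_diff_chain_at[OF assms] by (simp add: o_def)

text \<open>Differentiating \<open>p * (f o s)\<close> gives
  \<open>p' * (f o s) + (p * s') * (f' o s)\<close>, two terms of the same kind. Over
  \<open>A\<close> both vanish because \<open>p'\<close> and \<open>s'\<close> do; over the preimage
  of \<open>B\<close> the first needs \<open>f\<close> itself to vanish on \<open>B\<close>, not
  only its derivatives.\<close>

lemma smooth_flat_compose:
  fixes f :: "real \<Rightarrow> 'a::real_normed_vector"
  assumes s: "smooth_flat A s" and f: "smooth_flat B f" "\<And>x. x \<in> B \<Longrightarrow> f x = 0"
  shows "smooth_flat (A \<union> s -` B) (\<lambda>u. f (s u))"
proof (rule smooth_flat_coinduct_sum[where P = "\<lambda>h :: real \<Rightarrow> 'a. \<exists>p f. smooth_flat A p \<and> smooth_flat B f \<and>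
    (\<forall>x\<in>B. f x = 0) \<and> h = (\<lambda>u. p u *\<^sub>R f (s u))", OF finite_sum.base], goal_cases)
  case 1
  show ?case
    using f by (intro exI[of _ "\<lambda>_. 1"] exI[of _ f]) (auto intro: smooth_flat_const)
next
  case (2 h)
  then obtain p and f :: "real \<Rightarrow> 'a" where pf: "smooth_flat A p" "smooth_flat B f"
    "\<And>x. x \<in> B \<Longrightarrow> f x = 0" "h = (\<lambda>u. p u *\<^sub>R f (s u))" by blast
  from pf(1) obtain p' where p': "\<And>u. (p has_vector_derivative p' u) (at u)"
    "\<And>u. u \<in> A \<Longrightarrow> p' u = 0" "smooth_flat A p'" by (rule smooth_flatE) blast
  from pf(2) obtain f' where f': "\<And>u. (f has_vector_derivative f' u) (at u)"
    "\<And>u. u \<in> B \<Longrightarrow> f' u = 0" "smooth_flat B f'" by (rule smooth_flatE) blast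
  from s obtain s' where s': "\<And>u. (s has_vector_derivative s' u) (at u)"
    "\<And>u. u \<in> A \<Longrightarrow> s' u = 0" "smooth_flat A s'" by (rule smooth_flatE) blast
  define h1 where "h1 = (\<lambda>u. p' u *\<^sub>R f (s u))"
  define h2 where "h2 = (\<lambda>u. (p u * s' u) *\<^sub>R f' (s u))"
  let ?P = "\<lambda>h. \<exists>p f. smooth_flat A p \<and> smooth_flat B f \<and> (\<forall>x\<in>B. f x = 0) \<and> h = (\<lambda>u. p u *\<^sub>R f (s u))"
  have "?P h1" unfolding h1_def using p' pf by blast
  moreover have "?P h2" unfolding h2_def
    by (intro exI[of _ "\<lambda>u. p u * s' u"] exI[of _ f'] conjI smooth_flat_mult)
      (use pf f' s' in auto)
  ultimately have "finite_sum ?P (\<lambda>u. h1 u + h2 u)"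
    by (intro finite_sum.intros)
  moreover have "(h has_vector_derivative h1 u + h2 u) (at u)" for u
    unfolding h1_def h2_def pf(4)
    using has_vector_derivative_scaleR_fun[OF p'(1) has_vector_derivative_compose[OF s'(1) f'(1)], of u]
    by simp
  moreover have "h1 u + h2 u = 0" if "u \<in> A \<union> s -` B" for u
    using that unfolding h1_def h2_def using p'(2) s'(2) f'(2) pf(3) by auto
  ultimately show ?case by blast
qed

text \<open>The functions \<open>a * exp(-1/x^2) / x^k\<close>, extended by 0, all tend to 0 at the
  origin, and the derivative of each is a sum of two of them with larger \<open>k\<close>.\<close>

lemma smooth_flat_exp_inverse_square:
  "smooth_flat {0} (\<lambda>x::real. if x = 0 then 0 else exp (- (1 / x\<^sup>2)))"
proof -
  define e :: "real \<Rightarrow> nat \<Rightarrow> real \<Rightarrow> real"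
    where "e a k x = (if x = 0 then 0 else a * exp (- (1 / x\<^sup>2)) / x ^ k)" for a k x
  let ?P = "\<lambda>f. \<exists>a k. f = e a k"
  have lim: "((\<lambda>x. e a k x) \<longlongrightarrow> 0) (at 0)" for a k
  proof -
    \<comment> \<open>With \<open>y = 1/x^2\<close>, the function is
      \<open>a * x^k * (y^k / exp y)\<close>, and the exponential beats the power as
      \<open>y\<close> grows.\<close>
    have "((\<lambda>x::real. (1 / x\<^sup>2) ^ k / exp (1 / x\<^sup>2)) \<longlongrightarrow> 0) (at 0)"
      by (rule filterlim_compose[OF tendsto_power_div_exp_0]) real_asymp
    then have "((\<lambda>x::real. (a * x ^ k) * ((1 / x\<^sup>2) ^ k / exp (1 / x\<^sup>2))) \<longlongrightarrow> (a * 0 ^ k) * 0) (at 0)"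
      by (intro tendsto_intros) auto
    moreover have "\<forall>\<^sub>F x in at 0. (a * x ^ k) * ((1 / x\<^sup>2) ^ k / exp (1 / x\<^sup>2)) = e a k x"
      unfolding eventually_at_filter e_def
      by (rule always_eventually) (simp add: exp_minus field_simps power2_eq_square power_mult_distrib)
    ultimately show ?thesis
      by (simp add: Lim_transform_eventually)
  qed
  have deriv: "((e a k) has_vector_derivative (e (2 * a) (k + 3) x + e (- a * k) (k + 1) x)) (at x)" for a k x
  proof (cases "x = 0")
    case True
    \<comment> \<open>The difference quotient at the origin is again a function of the family, with
      \<open>k\<close> raised by one.\<close>
    have "((\<lambda>h. (e a k (0 + h) - e a k 0) / h) \<longlongrightarrow> 0) (at 0)"
      by (rule Lim_transform_eventually[OF lim[of a "Suc k"]])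
        (auto simp: eventually_at_filter e_def)
    then have "(e a k has_real_derivative 0) (at 0)"
      by (simp add: DERIV_def)
    then show ?thesis
      using True by (simp add: has_real_derivative_iff_has_vector_derivative e_def)
  next
    case False
    have "((\<lambda>x. a * exp (- (1 / x\<^sup>2)) / x ^ k) has_real_derivative
        (e (2 * a) (k + 3) x + e (- a * k) (k + 1) x)) (at x)"
    proof -
      have k: "real k * x ^ (k - Suc 0) = real k * x ^ k / x"
        using False by (cases k) auto
      show ?thesis
        unfolding e_def using False
        by (auto intro!: derivative_eq_intros simp: k)
          (simp add: field_simps power2_eq_square power3_eq_cube power4_eq_xxxx power_add)
    qed
    then have "((\<lambda>x. a * exp (- (1 / x\<^sup>2)) / x ^ k) has_vector_derivative
        (e (2 * a) (k + 3) x + e (- a * k) (k + 1) x)) (at x)"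
      by (simp add: has_real_derivative_iff_has_vector_derivative)
    then show ?thesis
      by (rule has_vector_derivative_transform_within_open[of _ _ _ "- {0}"])
        (use False in \<open>auto simp: e_def\<close>)
  qed
  have "smooth_flat {0} (e 1 0)"
  proof (rule smooth_flat_coinduct_sum[where P = ?P, OF finite_sum.base])
    show "?P (e 1 0)" by blast
  next
    fix f assume "?P f"
    then obtain a k where f: "f = e a k" by blast
    have "finite_sum ?P (\<lambda>x. e (2 * a) (k + 3) x + e (- a * k) (k + 1) x)"
      by (rule finite_sum.add; rule finite_sum.base; blast)
    moreover have "e (2 * a) (k + 3) 0 + e (- a * k) (k + 1) 0 = 0"
      by (simp add: e_def)
    ultimately show "\<exists>f'. finite_sum ?P f' \<and> (\<forall>u. (f has_vector_derivative f' u) (at u)) \<and>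
        (\<forall>u\<in>{0}. f' u = 0)"
      unfolding f using deriv by blast
  qed
  moreover have "e 1 0 = (\<lambda>x::real. if x = 0 then 0 else exp (- (1 / x\<^sup>2)))"
    by (auto simp: e_def)
  ultimately show ?thesis by simp
qed

text \<open>Differentiation multiplies by \<open>a\<close> and shifts the phase by
  \<open>pi/2\<close>, so sines with arbitrary amplitude and phase form a closed class.\<close>

lemma smooth_sin: "smooth_flat {} (\<lambda>u::real. sin (a * u))"
proof (rule smooth_flat_coinduct[where P = "\<lambda>f. \<exists>b c. f = (\<lambda>u::real. b * sin (a * u + c))"])
  show "\<exists>b c. (\<lambda>u. sin (a * u)) = (\<lambda>u. b * sin (a * u + c))"
    by (rule exI[of _ 1], rule exI[of _ 0]) simp
next
  fix f :: "real \<Rightarrow> real" assume "\<exists>b c. f = (\<lambda>u::real. b * sin (a * u + c))"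
  then obtain b c where f: "f = (\<lambda>u::real. b * sin (a * u + c))" by blast
  have "(f has_real_derivative (b * a) * sin (a * u + (c + pi / 2))) (at u)" for u
    unfolding f by (auto intro!: derivative_eq_intros simp: sin_add[of _ "pi/2"] cos_add sin_add algebra_simps)
  then show "\<exists>f'. (\<exists>b c. f' = (\<lambda>u. b * sin (a * u + c))) \<and>
      (\<forall>u. (f has_vector_derivative f' u) (at u)) \<and> (\<forall>u\<in>{}. f' u = 0)"
    by (intro exI[of _ "\<lambda>u. (b * a) * sin (a * u + (c + pi / 2))"])
     (auto simp: has_real_derivative_iff_has_vector_derivative)
qed

lemma antiderivative:
  fixes f :: "real \<Rightarrow> real"
  assumes "continuous_on UNIV f"
  obtains F where "F 0 = 0" "\<And>u. (F has_vector_derivative f u) (at u)"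
proof -
  obtain G where G: "\<And>x. (G has_vector_derivative f x) (at x)"
    using einterval_antiderivative[of "-\<infinity>" "\<infinity>" f] assms
    by (auto simp: continuous_on_eq_continuous_at)
  show ?thesis
    by (rule that[of "\<lambda>u. G u - G 0"])
      (auto intro!: derivative_eq_intros G)
qed

lemma has_vector_derivative_continuous_on_UNIV:
  assumes "\<And>u. (f has_vector_derivative f' u) (at u)"
  shows "continuous_on UNIV f"
  using assms by (meson continuous_at_imp_continuous_on has_vector_derivative_continuous)

text \<open>The derivative of \<open>s\<close> is a multiple of $\exp(-1/\sin^2(\pi u))$.\<close>

lemma flat_reparameterization:
  obtains s s' :: "real \<Rightarrow> real" and Q where "strict_mono s" "\<And>n. s (of_int n) = of_int n"
    "\<And>u. (s has_vector_derivative s' u) (at u)" "smooth_flat \<int> s" "smooth_flat \<int> s'"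
    "\<And>u. \<bar>s' u\<bar> \<le> Q"
proof -
  define e :: "real \<Rightarrow> real" where "e = (\<lambda>x::real. if x = 0 then 0 else exp (- (1 / x\<^sup>2)))"
  define p where "p u = e (sin (pi * u))" for u
  have Ints: "\<int> \<subseteq> {} \<union> (\<lambda>u. sin (pi * u)) -` {0}"
    by (auto simp: sin_zero_iff_int2 mult.commute elim!: Ints_cases)
  have "smooth_flat \<int> p"
    unfolding p_def
    by (rule smooth_flat_mono[OF smooth_flat_compose[OF smooth_sin _ _] Ints])
      (use smooth_flat_exp_inverse_square in \<open>auto simp: e_def\<close>)
  have p_nonneg: "p u \<ge> 0" and p_le: "p u \<le> 1" for u
    unfolding p_def e_def by auto
  have p_zero: "p u = 0 \<longleftrightarrow> u \<in> \<int>" for u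
    unfolding p_def e_def by (auto simp: sin_zero_iff_int2 elim!: Ints_cases)
  \<comment> \<open>The sine changes sign under the shift, but \<open>e\<close> is even.\<close>
  have p_periodic: "p (u + 1) = p u" for u
    unfolding p_def e_def by (simp add: distrib_left)
  obtain p' where "\<And>u. (p has_vector_derivative p' u) (at u)"
    using \<open>smooth_flat \<int> p\<close> by (rule smooth_flatE) blast
  then have "continuous_on UNIV p" by (rule has_vector_derivative_continuous_on_UNIV)
  then obtain S where S: "S 0 = 0" "\<And>u. (S has_vector_derivative p u) (at u)"
    by (rule antiderivative) blast
  then have Sd: "(S has_real_derivative p u) (at u)" for u
    by (simp add: has_real_derivative_iff_has_vector_derivative)
  \<comment> \<open>The density \<open>p\<close> vanishes only at integers, and every interval
    contains a non-integer, so \<open>S\<close> is constant on no interval.\<close>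
  have Smono: "S a < S b" if ab: "a < b" for a b
  proof -
    have mono: "S x \<le> S y" if "x \<le> y" for x y
      using that Sd p_nonneg by (meson DERIV_nonneg_imp_nondecreasing)
    have "S a \<noteq> S b"
    proof
      assume eq: "S a = S b"
      obtain x where x: "a < x" "x < b" "x \<notin> \<int>"
      proof -
        have "uncountable {a<..<b}" using ab by (simp add: uncountable_open_interval)
        moreover have "countable (\<int> :: real set)"
          by (metis Ints_def countable_image countable_subset subset_UNIV uncountable_def countableI_type)
        ultimately have "\<not> {a<..<b} \<subseteq> \<int>" using countable_subset by blast
        then obtain x where "x \<in> {a<..<b}" "x \<notin> \<int>" by blast
        then show ?thesis using that[of x] by simp
      qed
      have "S y = S a" if "y \<in> {a<..<b}" for y
        using mono[of a y] mono[of y b] eq that by auto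
      then have "((\<lambda>_. S a) has_vector_derivative p x) (at x)"
        by (intro has_vector_derivative_transform_within_open[OF S(2), of "{a<..<b}"])
          (use x in auto)
      then have "p x = 0"
        using vector_derivative_unique_at has_vector_derivative_const by blast
      with x p_zero show False by simp
    qed
    with mono[of a b] that show ?thesis by simp
  qed
  \<comment> \<open>This is the integral of \<open>p\<close> over one period. By periodicity
    \<open>S\<close> maps \<open>n\<close> to \<open>n * k\<close>, so dividing by \<open>k\<close>
    makes the integers fixed points.\<close>
  define k where "k = S 1"
  have "k > 0" using Smono[of 0 1] S by (simp add: k_def)
  have shift: "S (u + 1) = S u + k" for u
  proof -
    have "((\<lambda>u. S (u + 1) - S u) has_real_derivative 0) (at x)" for x
      by (auto intro!: derivative_eq_intros DERIV_chain2[of S "p (x + 1)" "\<lambda>u. u + 1"] Sd simp: p_periodic)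
    then have "S (u + 1) - S u = S (0 + 1) - S 0"
      using DERIV_isconst_all by blast
    then show ?thesis by (simp add: k_def S)
  qed
  have S_int: "S (of_int n) = of_int n * k" for n
  proof (induction n rule: int_induct[where k = 0])
    case base then show ?case by (simp add: S)
  next
    case (step1 i) then show ?case using shift[of "of_int i"] by (simp add: algebra_simps)
  next
    case (step2 i) then show ?case using shift[of "of_int i - 1"] by (simp add: algebra_simps)
  qed
  define s where "s u = (1 / k) * S u" for u
  define s' where "s' u = (1 / k) * p u" for u
  have sd: "(s has_vector_derivative s' u) (at u)" for u
    unfolding s_def s'_def by (auto intro!: derivative_eq_intros S)
  have s'flat: "smooth_flat \<int> s'"
    unfolding s'_def by (intro smooth_flat_mult smooth_flat_const \<open>smooth_flat \<int> p\<close>)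
  have s'0: "s' u = 0" if "u \<in> \<int>" for u
    using p_zero that by (simp add: s'_def)
  show ?thesis
  proof (rule that[of s s' "1/k"])
    show "strict_mono s"
      using Smono \<open>k > 0\<close> by (auto simp: strict_mono_def s_def divide_strict_right_mono)
    show "smooth_flat \<int> s"
      using sd s'0 s'flat by (rule smooth_flat_of_deriv)
    show "s (of_int n) = of_int n" for n
      using S_int \<open>k > 0\<close> by (simp add: s_def)
    show "\<bar>s' u\<bar> \<le> 1 / k" for u
      using p_nonneg[of u] p_le[of u] \<open>k > 0\<close> by (simp add: s'_def abs_mult divide_right_mono)
  qed (use sd s'flat in auto)
qed

text \<open>At an integer both adjacent pieces have derivative 0, so the one-sided derivatives
  agree. The pieces \<open>F'\<close> then match at the integers too, with common value 0, and
  coinduction continues.\<close>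

lemma smooth_flat_glue:
  fixes f :: "real \<Rightarrow> 'a::real_normed_vector"
  assumes "\<And>n::int. smooth_flat \<int> (F n)"
    and "\<And>(n::int) u. u \<in> {of_int n .. of_int n + 1} \<Longrightarrow> f u = F n u"
  shows "smooth_flat \<int> f"
proof (rule smooth_flat_coinduct[where P = "\<lambda>f :: real \<Rightarrow> 'a. \<exists>F :: int \<Rightarrow> real \<Rightarrow> 'a.
    (\<forall>n. smooth_flat \<int> (F n)) \<and> (\<forall>n. \<forall>u\<in>{of_int n .. of_int n + 1}. f u = F n u)"], goal_cases)
  case 1
  show ?case using assms by blast
next
  case (2 f)
  then obtain F :: "int \<Rightarrow> real \<Rightarrow> 'a" where F: "\<And>n. smooth_flat \<int> (F n)"
    "\<And>n u. u \<in> {of_int n .. of_int n + 1} \<Longrightarrow> f u = F n u" by blast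
  have "\<exists>F'. (\<forall>u. (F n has_vector_derivative F' u) (at u)) \<and> (\<forall>u\<in>\<int>. F' u = 0) \<and> smooth_flat \<int> F'" for n
    using F(1)[of n] by (rule smooth_flatE) blast
  then obtain F' where F': "\<And>n u. (F n has_vector_derivative F' n u) (at u)"
    "\<And>n u. u \<in> \<int> \<Longrightarrow> F' n u = 0" "\<And>n. smooth_flat \<int> (F' n)" by metis
  \<comment> \<open>At the right end of a unit interval the floor already selects the next piece;
    the value is still that of piece \<open>n\<close>, since both are 0.\<close>
  define f' where "f' u = F' \<lfloor>u\<rfloor> u" for u
  have f'_eq: "f' u = F' n u" if "u \<in> {of_int n .. of_int n + 1}" for n u
  proof (cases "u = of_int n + 1")
    case True
    then have "u \<in> \<int>" by simp
    then show ?thesis using F'(2) by (simp add: f'_def)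
  next
    case False
    with that have "\<lfloor>u\<rfloor> = n" by (simp add: floor_eq_iff)
    then show ?thesis by (simp add: f'_def)
  qed
  have piece: "(f has_vector_derivative f' u) (at u within {of_int n .. of_int n + 1})"
    if "u \<in> {of_int n .. of_int n + 1}" for n u
    using has_vector_derivative_transform[OF that F(2) has_vector_derivative_at_within[OF F'(1)]]
      f'_eq[OF that] by simp
  have "(f has_vector_derivative f' u) (at u)" for u
  proof (cases "u \<in> \<int>")
    case True
    then obtain n where u: "u = of_int n" by (auto elim: Ints_cases)
    have "(f has_vector_derivative f' u) (at u within {of_int (n - 1) .. of_int (n - 1) + 1} \<union> {of_int n .. of_int n + 1})"
      using piece[of u n] piece[of u "n - 1"] u
      unfolding has_vector_derivative_def has_derivative_within by (auto intro: Lim_Un)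
    moreover have "u \<in> interior ({of_int (n - 1) .. of_int (n - 1) + 1} \<union> {of_int n .. of_int n + 1})"
      by (rule interiorI[of "{of_int n - 1<..<of_int n + 1}"]) (use u in auto)
    ultimately show ?thesis by (metis at_within_interior)
  next
    case False
    define n where "n = \<lfloor>u\<rfloor>"
    have "of_int n < u" "u < of_int n + 1"
      using False unfolding n_def by (metis Ints_of_int floor_correct less_le, simp)
    then have "u \<in> interior {of_int n .. of_int n + 1}" by simp
    with piece[of u n] show ?thesis
      by (metis at_within_interior interior_subset subsetD)
  qed
  moreover have "f' u = 0" if "u \<in> \<int>" for u
    using F'(2) that by (simp add: f'_def)
  ultimately show ?case
    using F'(3) f'_eq by blast
qed

section \<open>A linear differential equation\<close>

lemma antiderivative_power_bound:
  fixes F f :: "real \<Rightarrow> real"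
  assumes "F 0 = 0" "\<And>u. (F has_vector_derivative f u) (at u)" "\<And>u. \<bar>f u\<bar> \<le> C * \<bar>u\<bar> ^ n"
  shows "\<bar>F u\<bar> \<le> C * \<bar>u\<bar> ^ Suc n / Suc n"
proof -
  \<comment> \<open>\<open>F\<close> and \<open>f\<close> are quantified afresh because the case of
    negative \<open>u\<close> applies this to the reflected function \<open>F (- u)\<close>.\<close>
  have pos: "\<bar>F u\<bar> \<le> C * u ^ Suc n / Suc n" if "u > 0" "F 0 = 0"
    "\<And>u. (F has_vector_derivative f u) (at u)" "\<And>u. \<bar>f u\<bar> \<le> C * \<bar>u\<bar> ^ n"
    for u and F f :: "real \<Rightarrow> real"
  proof -
    define P where "P u = C * u ^ Suc n / Suc n" for u
    have P: "(P has_vector_derivative C * u ^ n) (at u)" for u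
      unfolding P_def has_real_derivative_iff_has_vector_derivative[symmetric]
      by (auto intro!: derivative_eq_intros simp del: power_Suc of_nat_Suc)
    have "norm (F u - F 0) \<le> P u - P 0"
    proof (rule differentiable_bound_general[OF \<open>u > 0\<close>])
      show "continuous_on {0..u} F" "continuous_on {0..u} P"
        using has_vector_derivative_continuous_on_UNIV[of F, OF that(3)]
          has_vector_derivative_continuous_on_UNIV[of P, OF P]
        by (auto intro: continuous_on_subset)
      show "norm (f x) \<le> C * x ^ n" if "0 < x" for x
        using \<open>\<And>u. \<bar>f u\<bar> \<le> C * \<bar>u\<bar> ^ n\<close>[of x] that by simp
    qed (use that P in auto)
    then show ?thesis using \<open>F 0 = 0\<close> by (simp add: P_def)
  qed
  consider "u = 0" | "u > 0" | "u < 0" by linarith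
  then show ?thesis
  proof cases
    case 1 then show ?thesis using assms(1) by simp
  next
    case 2 then show ?thesis using pos[of u F f] assms by simp
  next
    case 3
    have "((\<lambda>u. F (- u)) has_vector_derivative - f (- x)) (at x)" for x
    proof -
      have "((\<lambda>x. - x) has_vector_derivative - 1) (at x)" for x :: real
        by (auto intro!: derivative_eq_intros)
      from has_vector_derivative_compose[OF this assms(2)] show ?thesis by simp
    qed
    then have "\<bar>F (- (- u))\<bar> \<le> C * (- u) ^ Suc n / Suc n"
      using pos[of "- u" "\<lambda>u. F (- u)" "\<lambda>u. - f (- u)"] assms 3
      by (metis abs_minus_cancel minus_zero neg_0_less_iff_less)
    with 3 show ?thesis by simp
  qed
qed

text \<open>The Picard iterates of the constant function 1 are nonnegative, so their sum is at least 1.\<close>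

lemma linear_ode_solution_ge_1:
  fixes q :: "real \<Rightarrow> real"
  assumes q: "continuous_on UNIV q" "\<And>u. 0 \<le> q u" "\<And>u. q u \<le> Q"
  obtains m m' where "\<And>u. (m has_vector_derivative m' u) (at u)"
    "\<And>u. (m' has_vector_derivative q u * m u) (at u)" "\<And>u. m u \<ge> 1"
proof -
  have "Q \<ge> 0" using q(2,3) order_trans by blast
  define prim where "prim f = (SOME F. F 0 = 0 \<and> (\<forall>u. (F has_vector_derivative f u) (at u)))"
    for f :: "real \<Rightarrow> real"
  have prim: "prim f 0 = 0" "(prim f has_vector_derivative f u) (at u)"
    if f: "continuous_on UNIV f" for f u
  proof -
    from f obtain F where "F 0 = 0" "\<And>u. (F has_vector_derivative f u) (at u)"
      by (rule antiderivative) blast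
    then have "\<exists>F. F 0 = 0 \<and> (\<forall>u. (F has_vector_derivative f u) (at u))" by blast
    from someI_ex[OF this] show "prim f 0 = 0" "(prim f has_vector_derivative f u) (at u)"
      unfolding prim_def by auto
  qed
  have prim_cont: "continuous_on UNIV (prim f)" if "continuous_on UNIV f" for f
    using prim(2)[OF that] by (rule has_vector_derivative_continuous_on_UNIV)
  \<comment> \<open>The condition \<open>x * y \<ge> 0\<close> keeps the intermediate point on the
    same side of 0 as \<open>x\<close>, which treats both half-lines at once.\<close>
  have mvt: "\<exists>y. x * y \<ge> 0 \<and> prim f x = x * f y" if f: "continuous_on UNIV f" for f x
  proof -
    have d: "(prim f has_real_derivative f u) (at u)" for u
      using prim(2)[OF f] by (simp add: has_real_derivative_iff_has_vector_derivative)
    consider "x = 0" | "x > 0" | "x < 0" by linarith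
    then show ?thesis
    proof cases
      case 1 then show ?thesis using prim(1)[OF f] by simp
    next
      case 2
      obtain z where "0 < z" "prim f x - prim f 0 = (x - 0) * f z"
        using MVT2[OF 2, of "prim f" f] d by blast
      then show ?thesis using prim(1)[OF f] 2 by (intro exI[of _ z]) auto
    next
      case 3
      obtain z where "z < 0" "prim f 0 - prim f x = (0 - x) * f z"
        using MVT2[OF 3, of "prim f" f] d by blast
      then show ?thesis using prim(1)[OF f] 3 by (intro exI[of _ z]) (auto simp: mult_nonpos_nonpos)
    qed
  qed
  \<comment> \<open>\<open>N k\<close> is the derivative of \<open>M (Suc k)\<close>, while that of
    \<open>M 0\<close> is 0, so the sum of the \<open>N k\<close> is the derivative of the sum of
    the \<open>M k\<close>.\<close>
  define M where "M k = ((\<lambda>f. prim (prim (\<lambda>u. q u * f u))) ^^ k) (\<lambda>_. 1)" for k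
  define N where "N k = prim (\<lambda>u. q u * M k u)" for k
  have M_Suc: "M (Suc k) = prim (N k)" for k by (simp add: M_def N_def)
  have M_0: "M 0 = (\<lambda>_. 1)" by (simp add: M_def)
  have contM: "continuous_on UNIV (M k)" for k
  proof (induction k)
    case 0 show ?case unfolding M_0 by simp
  next
    case (Suc k)
    then show ?case
      unfolding M_Suc N_def by (intro prim_cont continuous_intros q(1))
  qed
  have contqM: "continuous_on UNIV (\<lambda>u. q u * M k u)" for k
    by (intro continuous_intros q(1) contM)
  have contN: "continuous_on UNIV (N k)" for k
    unfolding N_def by (intro prim_cont contqM)
  have M_nonneg: "M k u \<ge> 0" for k u
  proof (induction k arbitrary: u)
    case 0 show ?case by (simp add: M_0)
  next
    case (Suc k)
    have N: "x * N k x \<ge> 0" for x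
    proof -
      obtain y where "N k x = x * (q y * M k y)"
        using mvt[OF contqM] unfolding N_def by blast
      then have "x * N k x = (x * x) * (q y * M k y)" by simp
      also have "\<dots> \<ge> 0" by (intro mult_nonneg_nonneg zero_le_square Suc q(2))
      finally show ?thesis .
    qed
    obtain y where y: "u * y \<ge> 0" "M (Suc k) u = u * N k y"
      using mvt[OF contN] unfolding M_Suc by blast
    show ?case
    proof (cases "y = 0")
      case True then show ?thesis using y(2) prim(1)[OF contqM] by (simp add: N_def)
    next
      case False
      \<comment> \<open>\<open>N k\<close> has the sign of its argument, and \<open>y\<close> the
        sign of \<open>u\<close>; multiplying by the square of \<open>y\<close> combines the two
        facts.\<close>
      have "u * N k y * y\<^sup>2 = (u * y) * (y * N k y)" by (simp add: power2_eq_square)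
      also have "\<dots> \<ge> 0" using y(1) N by simp
      finally show ?thesis using False y(2) by (simp add: zero_le_mult_iff)
    qed
  qed
  \<comment> \<open>Integrating twice divides by \<open>(2k+1)(2k+2)\<close>. Only a factor
    \<open>k+1\<close> is kept: \<open>k!\<close> in the denominator already gives an exponential
    series as majorant.\<close>
  have N_bound: "\<bar>N k u\<bar> \<le> Q ^ Suc k / fact k * \<bar>u\<bar> ^ Suc (2 * k)"
    if M: "\<And>u. \<bar>M k u\<bar> \<le> Q ^ k / fact k * \<bar>u\<bar> ^ (2 * k)" for k u
  proof -
    have "\<bar>q x * M k x\<bar> \<le> (Q ^ Suc k / fact k) * \<bar>x\<bar> ^ (2 * k)" for x
    proof -
      have "\<bar>q x * M k x\<bar> \<le> Q * (Q ^ k / fact k * \<bar>x\<bar> ^ (2 * k))"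
        unfolding abs_mult using q(2,3)[of x] M[of x] by (intro mult_mono) auto
      then show ?thesis by (simp add: mult.assoc)
    qed
    then have "\<bar>N k u\<bar> \<le> (Q ^ Suc k / fact k) * \<bar>u\<bar> ^ Suc (2 * k) / Suc (2 * k)"
      unfolding N_def using prim[OF contqM] by (intro antiderivative_power_bound)
    also have "\<dots> \<le> (Q ^ Suc k / fact k) * \<bar>u\<bar> ^ Suc (2 * k) / 1"
      using \<open>Q \<ge> 0\<close> by (intro divide_left_mono mult_nonneg_nonneg divide_nonneg_nonneg) auto
    finally show ?thesis by simp
  qed
  have M_bound: "\<bar>M k u\<bar> \<le> Q ^ k / fact k * \<bar>u\<bar> ^ (2 * k)" for k u
  proof (induction k arbitrary: u)
    case 0 show ?case by (simp add: M_0)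
  next
    case (Suc k)
    have "\<bar>M (Suc k) u\<bar> \<le> (Q ^ Suc k / fact k) * \<bar>u\<bar> ^ Suc (Suc (2 * k)) / Suc (Suc (2 * k))"
      unfolding M_Suc using prim[OF contN] N_bound[OF Suc] by (intro antiderivative_power_bound)
    also have "\<dots> \<le> (Q ^ Suc k / fact k) * \<bar>u\<bar> ^ Suc (Suc (2 * k)) / Suc k"
      using \<open>Q \<ge> 0\<close> by (intro divide_left_mono mult_nonneg_nonneg divide_nonneg_nonneg) auto
    finally show ?case by (simp add: mult.commute)
  qed
  have summable_power: "summable (\<lambda>k. c * (a ^ k / fact k))" for a c :: real
    using summable_exp[of a] by (simp add: divide_inverse mult.commute summable_mult)
  have Md: "(M k has_real_derivative (case k of 0 \<Rightarrow> 0 | Suc j \<Rightarrow> N j u)) (at u)" for k u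
    using prim(2)[OF contN]
    by (auto simp: M_0 M_Suc has_real_derivative_iff_has_vector_derivative split: nat.split)
  have Nd: "(N k has_real_derivative q u * M k u) (at u)" for k u
    using prim(2)[OF contqM] by (simp add: N_def has_real_derivative_iff_has_vector_derivative)
  have M_R: "norm (M k u) \<le> (Q * R\<^sup>2) ^ k / fact k" if "\<bar>u\<bar> \<le> R" for k u R
  proof -
    have "Q ^ k / fact k * \<bar>u\<bar> ^ (2 * k) \<le> Q ^ k / fact k * R ^ (2 * k)"
      using that \<open>Q \<ge> 0\<close> by (intro mult_left_mono power_mono) auto
    then show ?thesis
      using M_bound[of k u] by (simp add: power_mult power_mult_distrib)
  qed
  have N_R: "norm (N k u) \<le> (Q * R) * ((Q * R\<^sup>2) ^ k / fact k)" if "\<bar>u\<bar> \<le> R" for k u R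
  proof -
    have "Q ^ Suc k / fact k * \<bar>u\<bar> ^ Suc (2 * k) \<le> Q ^ Suc k / fact k * R ^ Suc (2 * k)"
      using that \<open>Q \<ge> 0\<close> by (intro mult_left_mono power_mono) auto
    also have "\<dots> = (Q * R) * ((Q * R\<^sup>2) ^ k / fact k)"
      by (simp add: power_mult power_mult_distrib)
    finally show ?thesis
      using N_bound[OF M_bound, of k u] by simp
  qed
  have M_summable: "summable (\<lambda>k. M k u)" for u
    by (rule summable_comparison_test'[OF summable_power[of 1 "Q * \<bar>u\<bar>\<^sup>2"], of 0])
      (use M_R[of u "\<bar>u\<bar>"] in simp)
  have N_summable: "summable (\<lambda>k. N k u)" for u
    by (rule summable_comparison_test'[OF summable_power[of "Q * \<bar>u\<bar>" "Q * \<bar>u\<bar>\<^sup>2"], of 0])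
      (use N_R[of u "\<bar>u\<bar>"] in simp)
  define m where "m u = (\<Sum>k. M k u)" for u
  define m' where "m' u = (\<Sum>k. N k u)" for u
  have m_deriv: "(m has_real_derivative m' u) (at u)" for u
  proof -
    \<comment> \<open>The added 1 puts \<open>u\<close> in the interior of the interval of uniform
      convergence.\<close>
    define R where "R = \<bar>u\<bar> + 1"
    have "uniformly_convergent_on {-R..R} (\<lambda>n x. \<Sum>k<n. case k of 0 \<Rightarrow> 0 | Suc j \<Rightarrow> N j x)"
    proof (rule Weierstrass_m_test')
      show "summable (\<lambda>k. case k of 0 \<Rightarrow> 0 | Suc j \<Rightarrow> (Q * R) * ((Q * R\<^sup>2) ^ j / fact j))"
        using summable_power by (subst summable_Suc_iff[symmetric]) simp
    qed (use N_R in \<open>auto split: nat.split\<close>)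
    then have "(m has_real_derivative (\<Sum>k. case k of 0 \<Rightarrow> 0 | Suc j \<Rightarrow> N j u)) (at u)"
      unfolding m_def
      by (intro has_field_derivative_series'(2)[of "{-R..R}" M _ u])
        (auto intro: DERIV_subset Md M_summable simp: R_def)
    also have "(\<Sum>k. case k of 0 \<Rightarrow> 0 | Suc j \<Rightarrow> N j u) = m' u"
      using suminf_split_head[of "\<lambda>k. case k of 0 \<Rightarrow> 0 | Suc j \<Rightarrow> N j u"] N_summable[of u]
        summable_Suc_iff[of "\<lambda>k. case k of 0 \<Rightarrow> 0 | Suc j \<Rightarrow> N j u"]
      by (simp add: m'_def)
    finally show ?thesis .
  qed
  have m'_deriv: "(m' has_real_derivative q u * m u) (at u)" for u
  proof -
    define R where "R = \<bar>u\<bar> + 1"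
    have "uniformly_convergent_on {-R..R} (\<lambda>n x. \<Sum>k<n. q x * M k x)"
    proof (rule Weierstrass_m_test')
      show "summable (\<lambda>k. Q * ((Q * R\<^sup>2) ^ k / fact k))" by (rule summable_power)
      show "norm (q x * M k x) \<le> Q * ((Q * R\<^sup>2) ^ k / fact k)" if "x \<in> {-R..R}" for k x
        unfolding norm_mult using q(2,3)[of x] M_R[of x R k] that by (intro mult_mono) auto
    qed
    then have "(m' has_real_derivative (\<Sum>k. q u * M k u)) (at u)"
      unfolding m'_def
      by (intro has_field_derivative_series'(2)[of "{-R..R}" N _ u])
        (auto intro: DERIV_subset Nd N_summable simp: R_def)
    then show ?thesis
      using suminf_mult[OF M_summable] by (simp add: m_def)
  qed
  have "m u \<ge> 1" for u
    using sum_le_suminf[OF M_summable[of u], of "{0}"] M_nonneg by (simp add: m_def M_0)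
  with m_deriv m'_deriv show ?thesis
    by (intro that) (auto simp: has_real_derivative_iff_has_vector_derivative)
qed

text \<open>Combinations \<open>a m + b m'\<close> with smooth coefficients are closed under
  differentiation: the equation replaces \<open>m''\<close> by \<open>q m\<close>, giving the
  coefficients \<open>a' + b q\<close> and \<open>a + b'\<close>.\<close>

lemma smooth_flat_linear_ode:
  fixes q m m' :: "real \<Rightarrow> real"
  assumes "smooth_flat {} q" "\<And>u. (m has_vector_derivative m' u) (at u)"
    "\<And>u. (m' has_vector_derivative q u * m u) (at u)"
  shows "smooth_flat {} m"
proof (rule smooth_flat_coinduct[where P = "\<lambda>h. \<exists>a b. smooth_flat {} a \<and> smooth_flat {} b \<and>
    h = (\<lambda>u. a u * m u + b u * m' u)"], goal_cases)
  case 1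
  show ?case
    by (rule exI[of _ "\<lambda>_. 1"], rule exI[of _ "\<lambda>_. 0"]) (simp add: smooth_flat_const)
next
  case (2 h)
  then obtain a b where ab: "smooth_flat {} a" "smooth_flat {} b" "h = (\<lambda>u. a u * m u + b u * m' u)"
    by blast
  from ab(1) obtain a' where a': "\<And>u. (a has_vector_derivative a' u) (at u)" "smooth_flat {} a'"
    by (rule smooth_flatE) blast
  from ab(2) obtain b' where b': "\<And>u. (b has_vector_derivative b' u) (at u)" "smooth_flat {} b'"
    by (rule smooth_flatE) blast
  have "(h has_vector_derivative (a' u + b u * q u) * m u + (a u + b' u) * m' u) (at u)" for u
    unfolding ab(3) using a'(1) b'(1) assms(2,3)
    unfolding has_real_derivative_iff_has_vector_derivative[symmetric]
    by (auto intro!: derivative_eq_intros simp: algebra_simps)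
  moreover have "smooth_flat {} (\<lambda>u. a' u + b u * q u)" "smooth_flat {} (\<lambda>u. a u + b' u)"
    using ab a' b' assms(1) by (auto intro!: smooth_flat_add smooth_flat_mult)
  ultimately show ?case by blast
qed

section \<open>Geodesics and horocycles\<close>

lemma hyperbolic_planeD:
  assumes "A \<in> hyperbolic_plane"
  shows "A $ 2 $ 1 = A $ 1 $ 2" "A $ 1 $ 1 > 0" "A $ 1 $ 1 * A $ 2 $ 2 - (A $ 1 $ 2)\<^sup>2 = 1"
proof -
  have tr: "transpose A = A" and pos: "\<And>x. x \<noteq> 0 \<Longrightarrow> x \<bullet> (A *v x) > 0" and det: "det A = 1"
    using assms unfolding hyperbolic_plane_def by auto
  show sym: "A $ 2 $ 1 = A $ 1 $ 2"
    using arg_cong[OF tr, of "\<lambda>B. B $ 1 $ 2"] by (simp add: transpose_def)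
  show "A $ 1 $ 1 > 0"
    using pos[of "axis 1 1"]
    by (simp add: axis_eq_0_iff matrix_vector_mult_basis column_def inner_axis')
  show "A $ 1 $ 1 * A $ 2 $ 2 - (A $ 1 $ 2)\<^sup>2 = 1"
    using det sym by (simp add: det_2 power2_eq_square)
qed

lemma hyperbolic_plane_quadratic_pos:
  assumes "A \<in> hyperbolic_plane" "x \<noteq> 0 \<or> y \<noteq> 0"
  shows "A $ 1 $ 1 * x\<^sup>2 + 2 * A $ 1 $ 2 * x * y + A $ 2 $ 2 * y\<^sup>2 > 0"
proof -
  let ?v = "vector [x, y] :: real^2"
  have "?v \<noteq> 0" using assms(2) by (auto simp: vec_eq_iff forall_2)
  then have "?v \<bullet> (A *v ?v) > 0"
    using assms(1) unfolding hyperbolic_plane_def by auto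
  then show ?thesis
    using hyperbolic_planeD(1)[OF assms(1)]
    by (simp add: inner_vec_def matrix_vector_mult_def sum_2 power2_eq_square algebra_simps)
qed

lemma has_vector_derivative_entry:
  assumes "(f has_vector_derivative f') F"
  shows "((\<lambda>t. f t $ i $ j) has_vector_derivative (f' $ i $ j)) F"
  by (rule bounded_linear.has_vector_derivative[OF bounded_linear_vec_nth
      bounded_linear.has_vector_derivative[OF bounded_linear_vec_nth assms]])

lemma has_vector_derivative_entries:
  fixes f :: "real \<Rightarrow> real^'n^'m"
  assumes "\<And>i j. ((\<lambda>t. f t $ i $ j) has_real_derivative (f' $ i $ j)) (at t within S)"
  shows "(f has_vector_derivative f') (at t within S)"
  unfolding has_vector_derivative_def
proof (subst has_derivative_componentwise_within, safe)
  fix b :: "real^'n^'m" assume "b \<in> Basis"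
  then obtain i j where b: "b = axis i (axis j 1)"
    by (auto simp: Basis_vec_def)
  show "((\<lambda>x. f x \<bullet> b) has_derivative (\<lambda>x. (x *\<^sub>R f') \<bullet> b)) (at t within S)"
    using assms[of i j] unfolding b has_field_derivative_def
    by (simp add: inner_axis mult_commute_abs)
qed

lemma matrix_inv_eqI:
  fixes A B :: "real^'n^'n"
  assumes "A ** B = mat 1" "B ** A = mat 1"
  shows "matrix_inv A = B"
proof -
  have "A ** matrix_inv A = mat 1 \<and> matrix_inv A ** A = mat 1"
    unfolding matrix_inv_def by (rule someI_ex) (use assms in blast)
  then have "matrix_inv A = matrix_inv A ** (A ** B)" "matrix_inv A ** A = mat 1"
    using assms by auto
  then show ?thesis
    by (metis matrix_mul_assoc matrix_mul_lid)
qed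

section \<open>The hyperbolic metric in the chart of first-row entries, and its geodesics\<close>

lemma partial_open:
  assumes "open M" "p \<in> M" "(F has_derivative F') (at p)"
  shows "partial M i F p = F' (axis i 1)"
  unfolding partial_def at_within_open[OF assms(2,1)]
  using frechet_derivative_at[OF assms(3)] by simp

lemma open_hyp_dom: "open hyp_dom"
  unfolding hyp_dom_def by (intro open_Collect_less continuous_intros)

lemma partial_hyp_dom:
  assumes "p \<in> hyp_dom" "\<And>q. q \<in> hyp_dom \<Longrightarrow> F q = f (q $ 1) (q $ 2)"
    "((\<lambda>q. f (q $ 1) (q $ 2)) has_derivative F') (at p)"
  shows "partial hyp_dom i F p = F' (axis i 1)"
proof (rule partial_open[OF open_hyp_dom assms(1)])
  show "(F has_derivative F') (at p)"
    by (rule has_derivative_transform_within_open[OF assms(3) open_hyp_dom assms(1)])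
      (use assms(2) in simp)
qed

lemmas has_derivative_nth [derivative_intros] = bounded_linear.has_derivative[OF bounded_linear_vec_nth]

lemma partial_hyp_param:
  assumes "p \<in> hyp_dom"
  shows "partial hyp_dom 1 hyp_param p =
      vector [vector [1, 0], vector [0, - (1 + (p $ 2)\<^sup>2) / (p $ 1)\<^sup>2]]"
    and "partial hyp_dom 2 hyp_param p =
      vector [vector [0, 1], vector [1, 2 * p $ 2 / p $ 1]]"
proof -
  have pos: "p $ 1 \<noteq> 0" using assms by (simp add: hyp_dom_def)
  define E11 E12 E22 :: "real^2^2" where "E11 = vector [vector [1, 0], vector [0, 0]]"
    and "E12 = vector [vector [0, 1], vector [1, 0]]" and "E22 = vector [vector [0, 0], vector [0, 1]]"
  note E_defs = E11_def E12_def E22_def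
  have eq: "hyp_param q = q $ 1 *\<^sub>R E11 + q $ 2 *\<^sub>R E12 + ((1 + (q $ 2)\<^sup>2) / q $ 1) *\<^sub>R E22" for q
    by (simp add: hyp_param_def E_defs vec_eq_iff forall_2)
  have d: "((\<lambda>q. q $ 1 *\<^sub>R E11 + q $ 2 *\<^sub>R E12 + ((1 + (q $ 2)\<^sup>2) / q $ 1) *\<^sub>R E22) has_derivative
     (\<lambda>h. h $ 1 *\<^sub>R E11 + h $ 2 *\<^sub>R E12 +
       (2 * p $ 2 * h $ 2 / p $ 1 - (1 + (p $ 2)\<^sup>2) * h $ 1 / (p $ 1)\<^sup>2) *\<^sub>R E22)) (at p)"
    using pos
    by (auto intro!: derivative_eq_intros simp: field_simps power2_eq_square)
  show "partial hyp_dom 1 hyp_param p =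
      vector [vector [1, 0], vector [0, - (1 + (p $ 2)\<^sup>2) / (p $ 1)\<^sup>2]]"
    "partial hyp_dom 2 hyp_param p = vector [vector [0, 1], vector [1, 2 * p $ 2 / p $ 1]]"
    unfolding partial_hyp_dom[OF assms eq d]
    by (simp_all add: E_defs vec_eq_iff forall_2 axis_def diff_divide_distrib add_divide_distrib)
qed

lemma hyp_metric_entries:
  assumes "p \<in> hyp_dom"
  shows "hyp_metric p $ 1 $ 1 = (1 + (p $ 2)\<^sup>2) / (p $ 1)\<^sup>2" "hyp_metric p $ 1 $ 2 = - p $ 2 / p $ 1"
    "hyp_metric p $ 2 $ 1 = - p $ 2 / p $ 1" "hyp_metric p $ 2 $ 2 = 1"
proof -
  have "p $ 1 \<noteq> 0" using assms by (simp add: hyp_dom_def)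
  then show "hyp_metric p $ 1 $ 1 = (1 + (p $ 2)\<^sup>2) / (p $ 1)\<^sup>2" "hyp_metric p $ 1 $ 2 = - p $ 2 / p $ 1"
    "hyp_metric p $ 2 $ 1 = - p $ 2 / p $ 1" "hyp_metric p $ 2 $ 2 = 1"
    unfolding hyp_metric_def
    by (simp_all add: partial_hyp_param[OF assms] hyp_form_def det_2 field_simps)
qed

text \<open>This is the Gauss formula of the unit hyperboloid, whose normal is the position vector:
  the second derivatives of \<open>hyp_param\<close> are their tangential part plus the metric times
  the position. The first-row entries are the coordinates themselves and have zero second
  derivatives, which leaves this identity. The proof checks it by computation.\<close>

lemma christoffel_hyp_metric:
  assumes p: "p \<in> hyp_dom"
  shows "christoffel hyp_dom hyp_metric p k i j = - (p $ k * hyp_metric p $ i $ j)"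
proof -
  have pos: "p $ 1 \<noteq> 0" using p by (simp add: hyp_dom_def)
  have inv: "matrix_inv (hyp_metric p) =
      vector [vector [(p $ 1)\<^sup>2, p $ 1 * p $ 2], vector [p $ 1 * p $ 2, 1 + (p $ 2)\<^sup>2]]"
    using pos
    by (intro matrix_inv_eqI)
      (auto simp: vec_eq_iff forall_2 matrix_matrix_mult_def sum_2 mat_def hyp_metric_entries[OF p]
        field_simps power2_eq_square)
  note partial = partial_hyp_dom[OF p]
  have p11: "partial hyp_dom l (\<lambda>q. hyp_metric q $ 1 $ 1) p =
      2 * p $ 2 / (p $ 1)\<^sup>2 * axis l 1 $ 2 - 2 * (1 + (p $ 2)\<^sup>2) / (p $ 1) ^ 3 * axis l 1 $ 1" for l
    by (rule partial[where f = "\<lambda>a b. (1 + b\<^sup>2) / a\<^sup>2", OF hyp_metric_entries(1)])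
      (use pos in \<open>auto intro!: derivative_eq_intros simp: field_simps power2_eq_square power3_eq_cube\<close>)
  have p12: "partial hyp_dom l (\<lambda>q. hyp_metric q $ 1 $ 2) p =
      p $ 2 / (p $ 1)\<^sup>2 * axis l 1 $ 1 - 1 / (p $ 1) * axis l 1 $ 2"
    "partial hyp_dom l (\<lambda>q. hyp_metric q $ 2 $ 1) p =
      p $ 2 / (p $ 1)\<^sup>2 * axis l 1 $ 1 - 1 / (p $ 1) * axis l 1 $ 2" for l
    by (rule partial[where f = "\<lambda>a b. - b / a", OF hyp_metric_entries(2)]
        partial[where f = "\<lambda>a b. - b / a", OF hyp_metric_entries(3)];
        use pos in \<open>auto intro!: derivative_eq_intros simp: field_simps power2_eq_square\<close>)+
  have p22: "partial hyp_dom l (\<lambda>q. hyp_metric q $ 2 $ 2) p = 0" for l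
    by (rule partial[where f = "\<lambda>a b. 1", OF hyp_metric_entries(4)]) auto
  have "\<forall>k i j. christoffel hyp_dom hyp_metric p k i j = - (p $ k * hyp_metric p $ i $ j)"
    unfolding christoffel_def inv forall_2 sum_2
    using pos
    by (simp add: p11 p12 p22 hyp_metric_entries[OF p] axis_def field_simps power2_eq_square power3_eq_cube)
  then show ?thesis by blast
qed

text \<open>At unit speed the Christoffel symbols turn the geodesic equation into
  \<open>x'' = x\<close> for the first row. Differentiating \<open>a z = 1 + b^2\<close> twice
  extends this to the last entry, so the derivatives alternate between \<open>c\<close> and
  \<open>c'\<close>.\<close>

lemma geodesic_smooth:
  assumes "arc_length_param c" "hyp_geodesic c"
  shows "smooth_flat {} c"
proof -
  obtain c' where c': "\<And>t. (c has_vector_derivative c' t) (at t)" "\<And>t. - det (c' t) = 1"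
    and rng: "\<And>t. c t \<in> hyperbolic_plane"
    using assms(1) unfolding arc_length_param_def by blast
  have geo: "geodesic hyp_dom hyp_metric (\<lambda>t. c t $ 1)"
    using assms(2) by (simp add: hyp_geodesic_def)
  then have dom: "c t $ 1 \<in> hyp_dom" for t
    by (auto simp: geodesic_def)
  obtain x' x'' where ex: "\<forall>t. ((\<lambda>t. c t $ 1) has_vector_derivative x' t) (at t)"
    "\<forall>t. (x' has_vector_derivative x'' t) (at t)"
    "\<forall>t k. x'' t $ k + (\<Sum>i\<in>UNIV. \<Sum>j\<in>UNIV.
        christoffel hyp_dom hyp_metric (c t $ 1) k i j * x' t $ i * x' t $ j) = 0"
    using geo unfolding geodesic_def by (elim conjE exE) (rule that; assumption)
  note x' = ex(1)[rule_format] ex(2)[rule_format] and eq = ex(3)[rule_format]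
  have "x' t = c' t $ 1" for t
    using x'(1) bounded_linear.has_vector_derivative[OF bounded_linear_vec_nth c'(1)]
    by (rule vector_derivative_unique_at)
  then have x'_eq: "x' = (\<lambda>t. c' t $ 1)" by blast
  define a b z where "a t = c t $ 1 $ 1" and "b t = c t $ 1 $ 2" and "z t = c t $ 2 $ 2" for t
  define a' b' z' where "a' t = c' t $ 1 $ 1" and "b' t = c' t $ 1 $ 2" and "z' t = c' t $ 2 $ 2" for t
  note entry = has_vector_derivative_entry[OF c'(1), folded has_real_derivative_iff_has_vector_derivative]
  have da: "(a has_real_derivative a' t) (at t)" and db: "(b has_real_derivative b' t) (at t)"
    and dz: "(z has_real_derivative z' t) (at t)" for t
    unfolding a_def b_def z_def a'_def b'_def z'_def by (rule entry)+
  have sym': "c' t $ 2 $ 1 = b' t" for t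
  proof -
    have "(b has_real_derivative c' t $ 2 $ 1) (at t)"
      using entry[of 2 1 t] hyperbolic_planeD(1)[OF rng] by (simp add: b_def[abs_def])
    then show ?thesis using db DERIV_unique by blast
  qed
  have apos: "a t > 0" and az: "a t * z t = 1 + (b t)\<^sup>2" for t
    using hyperbolic_planeD[OF rng, of t] by (auto simp: a_def b_def z_def)
  have az': "a' t * z t + a t * z' t = 2 * b t * b' t" for t
  proof -
    have "((\<lambda>t. a t * z t) has_real_derivative a' t * z t + a t * z' t) (at t)"
      by (auto intro!: derivative_eq_intros da dz)
    moreover have "((\<lambda>t. a t * z t) has_real_derivative 2 * b t * b' t) (at t)"
      unfolding az by (auto intro!: derivative_eq_intros db)
    ultimately show ?thesis by (rule DERIV_unique)
  qed
  have unit: "(b' t)\<^sup>2 - a' t * z' t = 1" for t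
    using c'(2)[of t] sym' by (simp add: det_2 a'_def b'_def z'_def power2_eq_square)
  have acc: "x'' t $ k = c t $ 1 $ k" for t k
  proof -
    have ne: "a t \<noteq> 0" using apos[of t] by simp
    \<comment> \<open>Eliminating \<open>z\<close> and \<open>z'\<close> from
      \<open>- det (c' t) = 1\<close> gives the speed measured in the chart.\<close>
    have "(\<Sum>i\<in>UNIV. \<Sum>j\<in>UNIV. hyp_metric (c t $ 1) $ i $ j * x' t $ i * x' t $ j) = 1"
    proof -
      have z: "z t = (1 + (b t)\<^sup>2) / a t" using az[of t] ne by (simp add: field_simps)
      have z': "z' t = (2 * b t * b' t - a' t * z t) / a t" using az'[of t] ne by (simp add: field_simps)
      have "(\<Sum>i\<in>UNIV. \<Sum>j\<in>UNIV. hyp_metric (c t $ 1) $ i $ j * x' t $ i * x' t $ j)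
          = (1 + (b t)\<^sup>2) / (a t)\<^sup>2 * (a' t)\<^sup>2 - 2 * b t / a t * a' t * b' t + (b' t)\<^sup>2"
        unfolding sum_2 hyp_metric_entries[OF dom] x'_eq a_def b_def a'_def b'_def
        by (simp add: power2_eq_square mult_ac)
      also have "\<dots> = (b' t)\<^sup>2 - a' t * z' t"
        unfolding z' z using ne by (simp add: field_simps power2_eq_square)
      finally show ?thesis using unit by simp
    qed
    moreover have "x'' t $ k = c t $ 1 $ k * (\<Sum>i\<in>UNIV. \<Sum>j\<in>UNIV. hyp_metric (c t $ 1) $ i $ j * x' t $ i * x' t $ j)"
      using eq[of t k] unfolding christoffel_hyp_metric[OF dom] sum_2 by (simp add: algebra_simps)
    ultimately show ?thesis by simp
  qed
  have dx: "((\<lambda>t. c' t $ 1 $ k) has_real_derivative c t $ 1 $ k) (at t)" for k t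
    using bounded_linear.has_vector_derivative[OF bounded_linear_vec_nth x'(2), of k t]
    unfolding acc x'_eq has_real_derivative_iff_has_vector_derivative .
  have da': "(a' has_real_derivative a t) (at t)" and db': "(b' has_real_derivative b t) (at t)" for t
    unfolding a'_def b'_def a_def b_def by (rule dx)+
  have dz': "(z' has_real_derivative z t) (at t)" for t
  proof -
    have ne: "a t \<noteq> 0" for t using apos[of t] by simp
    have "z' = (\<lambda>t. (2 * b t * b' t - a' t * z t) / a t)"
      using az' ne by (auto simp: field_simps)
    moreover have "((\<lambda>t. (2 * b t * b' t - a' t * z t) / a t) has_real_derivative
      ((2 * b' t * b' t + 2 * b t * b t - a t * z t - a' t * z' t) * a t
        - (2 * b t * b' t - a' t * z t) * a' t) / (a t * a t)) (at t)"
      using ne by (auto intro!: derivative_eq_intros da db da' db' dz simp: algebra_simps)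
    moreover have "(2 * b' t * b' t + 2 * b t * b t - a t * z t - a' t * z' t) * a t
        - (2 * b t * b' t - a' t * z t) * a' t = z t * (a t * a t)"
    proof -
      have "2 * b t * b' t - a' t * z t = a t * z' t" using az'[of t] by simp
      then have "(2 * b' t * b' t + 2 * b t * b t - a t * z t - a' t * z' t) * a t
          - (2 * b t * b' t - a' t * z t) * a' t
        = (2 * ((b' t)\<^sup>2 - a' t * z' t) + 2 * (b t)\<^sup>2 - a t * z t) * a t"
        by (simp add: algebra_simps power2_eq_square)
      also have "\<dots> = z t * (a t * a t)"
        unfolding unit using az[of t] by (simp add: algebra_simps)
      finally show ?thesis .
    qed
    ultimately show ?thesis using ne by simp
  qed
  have "(c' has_vector_derivative c t) (at t)" for t
  proof (rule has_vector_derivative_entries)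
    have "\<forall>i j. ((\<lambda>t. c' t $ i $ j) has_real_derivative c t $ i $ j) (at t)"
      unfolding forall_2 using da' db' dz' sym' hyperbolic_planeD(1)[OF rng]
      by (simp add: a_def b_def z_def a'_def[abs_def] b'_def[abs_def] z'_def[abs_def])
    then show "((\<lambda>t. c' t $ i $ j) has_real_derivative c t $ i $ j) (at t)" for i j by blast
  qed
  with c'(1) show ?thesis
    unfolding smooth_flat_def
    by (intro exI[of _ "\<lambda>k. if even k then c else c'"]) auto
qed

section \<open>Unipotent subgroups and horocycles\<close>

text \<open>$v (Jv)^T$ with $v = (x, y)$ and $J$ the rotation by a right angle. Up to a factor, these are
  all nilpotent matrices.\<close>

definition null_matrix :: "real \<Rightarrow> real \<Rightarrow> real^2^2" where
  "null_matrix x y = vector [vector [- (x * y), x\<^sup>2], vector [- y\<^sup>2, x * y]]"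

text \<open>The first row of \<open>k *\<^sub>R null_matrix x y\<close> is \<open>k * x\<close>
  times \<open>(- y, x)\<close>, so the vector can be read off from the first row of
  \<open>X\<close>, unless \<open>X $ 1 $ 2\<close> vanishes; then it is
  \<open>(0, 1)\<close>.\<close>

lemma null_matrix_exists:
  fixes X :: "real^2^2"
  assumes "X $ 2 $ 2 = - X $ 1 $ 1" "det X = 0" "X \<noteq> 0"
  obtains k x y where "X = k *\<^sub>R null_matrix x y" "k \<noteq> 0" "x \<noteq> 0 \<or> y \<noteq> 0"
proof -
  have d: "(X $ 1 $ 1)\<^sup>2 = - X $ 1 $ 2 * X $ 2 $ 1"
    using assms(1,2) by (simp add: det_2 power2_eq_square algebra_simps)
  show ?thesis
  proof (cases "X $ 1 $ 2 = 0")
    case True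
    with d have "X $ 1 $ 1 = 0" by simp
    with True assms have "X $ 2 $ 1 \<noteq> 0" by (auto simp: vec_eq_iff forall_2)
    with True \<open>X $ 1 $ 1 = 0\<close> assms(1) show ?thesis
      by (intro that[of "- X $ 2 $ 1" 0 1]) (auto simp: null_matrix_def vec_eq_iff forall_2)
  next
    case False
    then show ?thesis
      using d assms(1)
      by (intro that[of "1 / X $ 1 $ 2" "X $ 1 $ 2" "- X $ 1 $ 1"])
        (auto simp: null_matrix_def vec_eq_iff forall_2 power2_eq_square field_simps)
  qed
qed

text \<open>On traceless matrices the trace of \<open>X ** Y\<close> is a Lorentzian form with
  quadratic form \<open>-2 det\<close>. Two orthogonal null vectors of such a form are
  parallel.\<close>

lemma null_matrix_parallel:
  fixes Y :: "real^2^2"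
  assumes "Y $ 2 $ 2 = - Y $ 1 $ 1" "det Y = 0" and ne: "x \<noteq> 0 \<or> y \<noteq> 0"
    and orth: "(null_matrix x y ** Y) $ 1 $ 1 + (null_matrix x y ** Y) $ 2 $ 2 = 0"
  shows "\<exists>k. Y = k *\<^sub>R null_matrix x y"
proof -
  define p q r where "p = Y $ 1 $ 1" and "q = Y $ 1 $ 2" and "r = Y $ 2 $ 1"
  have Y22: "Y $ 2 $ 2 = - p" using assms(1) by (simp add: p_def)
  have d: "p\<^sup>2 + q * r = 0"
    using assms(1,2) by (simp add: det_2 power2_eq_square algebra_simps p_def q_def r_def)
  have o: "x\<^sup>2 * r = 2 * x * y * p + y\<^sup>2 * q"
    using orth by (simp add: matrix_matrix_mult_def sum_2 null_matrix_def Y22 algebra_simps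
        flip: p_def q_def r_def)
  show ?thesis
  proof (cases "x = 0")
    case True
    with ne o have "q = 0" "y \<noteq> 0" by auto
    with d have "p = 0" by simp
    with \<open>q = 0\<close> \<open>y \<noteq> 0\<close> True Y22 show ?thesis
      by (intro exI[of _ "- r / y\<^sup>2"])
        (simp add: null_matrix_def vec_eq_iff forall_2 flip: p_def q_def r_def)
  next
    case False
    \<comment> \<open>The square is a combination of the null condition \<open>d\<close> and the
      orthogonality \<open>o\<close>, so it vanishes.\<close>
    have "(x * p + y * q)\<^sup>2 = x\<^sup>2 * (p\<^sup>2 + q * r) + q * (2 * x * y * p + y\<^sup>2 * q - x\<^sup>2 * r)"
      by (simp add: power2_eq_square algebra_simps)
    also have "\<dots> = 0" using d o by simp
    finally have p: "p = - y * q / x" using False by (simp add: field_simps)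
    have r: "r = - y\<^sup>2 * q / x\<^sup>2"
      using o False unfolding p by (simp add: field_simps power2_eq_square)
    show ?thesis
      using False Y22 p r
      by (intro exI[of _ "q / x\<^sup>2"])
        (simp add: null_matrix_def vec_eq_iff forall_2 power2_eq_square field_simps flip: p_def q_def r_def)
  qed
qed

lemma det_matrix_funpow: "det ((((**) X) ^^ k) (mat 1)) = (det X) ^ k" for X :: "real^'n^'n"
  by (induction k) (auto simp: det_mul)

text \<open>A nilpotent matrix has determinant 0. As \<open>det (U - 1) = det U - tr U + 1\<close>,
  the trace of \<open>U\<close> is 2, so \<open>U - 1\<close> is traceless.\<close>

lemma unipotent_minus_one:
  fixes U :: "real^2^2"
  assumes "unipotent U" "det U = 1"
  shows "det (U - mat 1) = 0" "(U - mat 1) $ 2 $ 2 = - (U - mat 1) $ 1 $ 1"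
proof -
  obtain k where "(((**) (U - mat 1)) ^^ k) (mat 1) = 0"
    using assms(1) unfolding unipotent_def by blast
  then have "det (U - mat 1) ^ k = det (0 :: real^2^2)"
    by (simp flip: det_matrix_funpow)
  then show d: "det (U - mat 1) = 0" by (simp add: det_2)
  show "(U - mat 1) $ 2 $ 2 = - (U - mat 1) $ 1 $ 1"
    using d assms(2) by (simp add: det_2 mat_def algebra_simps)
qed

text \<open>With \<open>N t = U t - 1\<close>, the group law reads
  \<open>N (t0 + t) = N t0 + N t + N t0 ** N t\<close>. Taking traces makes \<open>N t\<close>
  orthogonal to \<open>N t0\<close>, hence parallel to it, so the subgroup lies in one line. How the
  position on this line depends on \<open>t\<close> is left open.\<close>

lemma horocycle_subset:
  assumes "horocycle h"
  obtains A x y where "A \<in> hyperbolic_plane" "x \<noteq> 0 \<or> y \<noteq> 0"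
    "h \<subseteq> range (\<lambda>\<tau>. (mat 1 + \<tau> *\<^sub>R null_matrix x y) ** A ** transpose (mat 1 + \<tau> *\<^sub>R null_matrix x y))"
proof -
  obtain U A where A: "A \<in> hyperbolic_plane" and U: "unipotent_subgroup U"
    and h: "h = range (\<lambda>t. U t ** A ** transpose (U t))"
    using assms unfolding horocycle_def by blast
  define N where "N t = U t - mat 1" for t
  have detN: "det (N t) = 0" and trN: "N t $ 2 $ 2 = - N t $ 1 $ 1" for t
    using unipotent_minus_one[of "U t"] U unfolding unipotent_subgroup_def N_def by blast+
  obtain t0 where "N t0 \<noteq> 0"
    using U unfolding unipotent_subgroup_def N_def by (metis right_minus_eq)
  with detN trN obtain k x y where N0: "N t0 = k *\<^sub>R null_matrix x y" "k \<noteq> 0" "x \<noteq> 0 \<or> y \<noteq> 0"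
    by (metis null_matrix_exists)
  have "\<exists>j. U t = mat 1 + j *\<^sub>R null_matrix x y" for t
  proof -
    have "U (t0 + t) = U t0 ** U t" using U unfolding unipotent_subgroup_def by blast
    also have "\<dots> = (mat 1 + N t0) ** (mat 1 + N t)" by (simp add: N_def)
    also have "\<dots> = mat 1 + (N t0 + N t + N t0 ** N t)"
      by (simp add: vec_eq_iff forall_2 matrix_matrix_mult_def sum_2 mat_def algebra_simps)
    finally have "N (t0 + t) = N t0 + N t + N t0 ** N t"
      by (simp add: N_def)
    then have "(N t0 ** N t) $ 1 $ 1 + (N t0 ** N t) $ 2 $ 2 = 0"
      using trN[of t] trN[of t0] trN[of "t0 + t"] by simp
    then have "k * ((null_matrix x y ** N t) $ 1 $ 1 + (null_matrix x y ** N t) $ 2 $ 2) = 0"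
      unfolding N0(1) by (simp add: matrix_matrix_mult_def sum_2 algebra_simps)
    then have "\<exists>j. N t = j *\<^sub>R null_matrix x y"
      using N0 trN detN by (intro null_matrix_parallel) auto
    then show ?thesis unfolding N_def by (metis add.commute diff_add_cancel)
  qed
  then show ?thesis
    unfolding h using that[OF A N0(3)] h by (metis (mono_tags, lifting) image_subset_iff rangeI)
qed

text \<open>The parameter \<open>\<tau>\<close> along the horocycle is recovered by the linear functional
  $L(X) = v^T X (Jv)$, and unit speed means $\tau'^2 = k^{-2}$, so that \<open>\<tau>'\<close> is constant.\<close>

lemma horocycle_smooth:
  assumes "arc_length_param c" "horocycle h" "range c \<subseteq> h"
  shows "smooth_flat {} c"
proof -
  obtain c' where c': "\<And>t. (c has_vector_derivative c' t) (at t)" "\<And>t. - det (c' t) = 1"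
    and cont: "continuous_on UNIV c'"
    using assms(1) unfolding arc_length_param_def by blast
  obtain A x y where A: "A \<in> hyperbolic_plane" and xy: "x \<noteq> 0 \<or> y \<noteq> 0"
    and h: "h \<subseteq> range (\<lambda>\<tau>. (mat 1 + \<tau> *\<^sub>R null_matrix x y) ** A ** transpose (mat 1 + \<tau> *\<^sub>R null_matrix x y))"
    using assms(2) by (rule horocycle_subset)
  have "\<exists>\<tau>. c t = (mat 1 + \<tau> *\<^sub>R null_matrix x y) ** A ** transpose (mat 1 + \<tau> *\<^sub>R null_matrix x y)" for t
    using assms(3) h by blast
  then obtain \<tau> where \<tau>: "\<And>t. c t = (mat 1 + \<tau> t *\<^sub>R null_matrix x y) ** A ** transpose (mat 1 + \<tau> t *\<^sub>R null_matrix x y)"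
    by metis
  \<comment> \<open>With \<open>w = A (Jv)\<close>, the product expands to
    \<open>A + \<tau> B + \<tau>^2 C\<close>, where \<open>B = v w^T + w v^T\<close>,
    \<open>C = k v v^T\<close> and \<open>k = (Jv)^T A (Jv)\<close>.\<close>
  define w1 w2 where "w1 = A $ 1 $ 2 * x - A $ 1 $ 1 * y" and "w2 = A $ 2 $ 2 * x - A $ 1 $ 2 * y"
  define k where "k = x * w2 - y * w1"
  have "k > 0"
    using hyperbolic_plane_quadratic_pos[OF A, of "- y" x] xy
    by (auto simp: k_def w1_def w2_def power2_eq_square algebra_simps)
  define B C :: "real^2^2" where
    "B = vector [vector [2 * x * w1, x * w2 + y * w1], vector [x * w2 + y * w1, 2 * y * w2]]"
    and "C = vector [vector [k * x\<^sup>2, k * x * y], vector [k * x * y, k * y\<^sup>2]]"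
  have c_eq: "c t = A + \<tau> t *\<^sub>R B + (\<tau> t * \<tau> t) *\<^sub>R C" for t
    unfolding \<tau>[of t] using hyperbolic_planeD(1)[OF A]
    by (simp add: vec_eq_iff forall_2 matrix_matrix_mult_def transpose_def sum_2 mat_def null_matrix_def
        B_def C_def k_def w1_def w2_def power2_eq_square algebra_simps)
  \<comment> \<open>This is \<open>L B\<close>, whereas \<open>L C = 0\<close> because
    \<open>v\<close> and \<open>Jv\<close> are orthogonal.\<close>
  define n where "n = k * (x\<^sup>2 + y\<^sup>2)"
  have "n \<noteq> 0" using \<open>k > 0\<close> xy by (auto simp: n_def sum_power2_eq_zero_iff)
  define L :: "real^2^2 \<Rightarrow> real" where
    "L X = x * (x * X $ 1 $ 2 - y * X $ 1 $ 1) + y * (x * X $ 2 $ 2 - y * X $ 1 $ 2)" for X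
  have L_eq: "\<tau> t = (L (c t) - L A) / n" for t
  proof -
    have "L (c t) - L A = \<tau> t * n"
      unfolding c_eq L_def B_def C_def n_def k_def
      by (simp add: power2_eq_square algebra_simps)
    then show ?thesis using \<open>n \<noteq> 0\<close> by simp
  qed
  define \<tau>' where "\<tau>' t = L (c' t) / n" for t
  note entry = has_vector_derivative_entry[OF c'(1), folded has_real_derivative_iff_has_vector_derivative]
  have d\<tau>: "(\<tau> has_real_derivative \<tau>' t) (at t)" for t
  proof -
    have "((\<lambda>t. (L (c t) - L A) / n) has_real_derivative L (c' t) / n) (at t)"
      unfolding L_def using \<open>n \<noteq> 0\<close>
      by (auto intro!: derivative_eq_intros entry simp: field_simps)
    then show ?thesis unfolding L_eq[symmetric] \<tau>'_def .
  qed
  then have d\<tau>v: "(\<tau> has_vector_derivative \<tau>' t) (at t)" for t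
    by (simp add: has_real_derivative_iff_has_vector_derivative)
  have c'_eq: "c' t = \<tau>' t *\<^sub>R (B + (2 * \<tau> t) *\<^sub>R C)" for t
  proof (rule vector_derivative_unique_at[OF c'(1)])
    have "((\<lambda>t. A + \<tau> t *\<^sub>R B + (\<tau> t * \<tau> t) *\<^sub>R C) has_vector_derivative
        \<tau>' t *\<^sub>R B + (\<tau>' t * \<tau> t + \<tau> t * \<tau>' t) *\<^sub>R C) (at t)"
      by (auto intro!: derivative_eq_intros d\<tau>)
    then show "(c has_vector_derivative \<tau>' t *\<^sub>R (B + (2 * \<tau> t) *\<^sub>R C)) (at t)"
      unfolding c_eq[symmetric] by (simp add: algebra_simps)
  qed
  have "- det (c' t) = (\<tau>' t)\<^sup>2 * k\<^sup>2" for t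
    unfolding c'_eq det_2 B_def C_def k_def
    by (simp add: power2_eq_square algebra_simps)
  then have "(\<tau>' t * k)\<^sup>2 = 1" for t
    using c'(2)[of t] by (simp add: power_mult_distrib)
  then have "\<tau>' t * k \<in> {1, -1}" for t
    by (simp add: power2_eq_1_iff)
  then have "\<tau>' t \<in> {1 / k, -1 / k}" for t
    using \<open>k > 0\<close> by (auto simp: field_simps)
  \<comment> \<open>Only \<open>1/k\<close> and \<open>-1/k\<close> can occur; continuity of
    \<open>c'\<close> excludes switching between them.\<close>
  then have "finite (range \<tau>')"
    by (meson finite.emptyI finite.insertI finite_subset image_subsetI)
  moreover have "continuous_on UNIV \<tau>'"
    unfolding \<tau>'_def L_def using cont by (intro continuous_intros) (use \<open>n \<noteq> 0\<close> in auto)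
  ultimately have "\<tau>' constant_on UNIV"
    by (intro continuous_finite_range_constant connected_UNIV)
  then obtain e where "\<tau>' = (\<lambda>_. e)" unfolding constant_on_def by auto
  then have "smooth_flat {} \<tau>"
    using d\<tau>v by (intro smooth_flat_of_deriv[of \<tau> \<tau>']) (auto simp: smooth_flat_const)
  then have "smooth_flat {} (\<lambda>t. A + \<tau> t *\<^sub>R B + (\<tau> t * \<tau> t) *\<^sub>R C)"
    by (intro smooth_flat_add smooth_flat_scaleR smooth_flat_mult smooth_flat_const)
  then show ?thesis unfolding c_eq[symmetric] .
qed

section \<open>The Ricci tensor of a plane wave\<close>

lemma vector_4:
  "(vector [x, y, z, w] :: 'a::zero^4) $ 1 = x" "(vector [x, y, z, w] :: 'a^4) $ 2 = y"
  "(vector [x, y, z, w] :: 'a^4) $ 3 = z" "(vector [x, y, z, w] :: 'a^4) $ 4 = w"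
  unfolding vector_def by simp_all

text \<open>A derivative within the slab is determined only if the slab leaves room in every
  coordinate direction. Along \<open>i1\<close> this room comes from \<open>V\<close> being a
  nondegenerate interval, also at its endpoints.\<close>

lemma partial_slab:
  fixes F :: "real^'n::finite \<Rightarrow> real" and V :: "real set" and i1 :: 'n
  assumes V: "is_interval V" "v \<in> V" "v' \<in> V" "v \<noteq> v'"
    and p: "p $ i1 \<in> V" and F: "\<And>q. q $ i1 \<in> V \<Longrightarrow> F q = f (q $ i1)"
    and f: "(f has_real_derivative f') (at (p $ i1))"
  shows "partial {p. p $ i1 \<in> V} i F p = (if i = i1 then f' else 0)"
proof -
  let ?M = "{p. p $ i1 \<in> V}"
  have df: "((\<lambda>q. f (q $ i1)) has_derivative (\<lambda>h. h $ i1 * f')) (at p)"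
    using has_derivative_compose[of "\<lambda>q. q $ i1" "\<lambda>h. h $ i1" p UNIV f "\<lambda>x. x * f'"] f
      bounded_linear_imp_has_derivative[OF bounded_linear_vec_nth[of i1], of "at p"]
    by (simp add: has_field_derivative_def mult_commute_abs)
  have d: "(F has_derivative (\<lambda>h. h $ i1 * f')) (at p within ?M)"
    by (rule has_derivative_transform[OF _ _ has_derivative_at_withinI[OF df]]) (simp_all add: p F)
  have "frechet_derivative F (at p within ?M) = (\<lambda>h. h $ i1 * f')"
  proof (rule frechet_derivative_unique_within)
    show "(F has_derivative frechet_derivative F (at p within ?M)) (at p within ?M)"
      using d by (metis differentiableI frechet_derivative_works)
    show "(F has_derivative (\<lambda>h. h $ i1 * f')) (at p within ?M)" by (rule d)
    fix b :: "real^'n" and e :: real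
    assume "b \<in> Basis" "e > 0"
    then obtain j where b: "b = axis j 1" by (auto simp: Basis_vec_def)
    show "\<exists>d. 0 < \<bar>d\<bar> \<and> \<bar>d\<bar> < e \<and> p + d *\<^sub>R b \<in> ?M"
    proof (cases "j = i1")
      case False
      then show ?thesis using \<open>e > 0\<close> p by (intro exI[of _ "e / 2"]) (simp add: b axis_def)
    next
      case True
      obtain u where u: "u \<in> V" "u \<noteq> p $ i1" using V by metis
      \<comment> \<open>A step towards another point \<open>u\<close> of \<open>V\<close>, at most
        up to it and shorter than \<open>e\<close>.\<close>
      define d where "d = (if u > p $ i1 then min (u - p $ i1) (e / 2) else - min (p $ i1 - u) (e / 2))"
      have "p $ i1 + d \<in> V"
        using V(1) u p \<open>e > 0\<close> unfolding is_interval_1 d_def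
        by (smt (verit) min_def field_sum_of_halves)
      then show ?thesis
        using u \<open>e > 0\<close> True by (intro exI[of _ d]) (auto simp: b d_def)
    qed
  qed
  then show ?thesis unfolding partial_def by (simp add: axis_def)
qed

definition wave_matrix :: "real \<Rightarrow> real \<Rightarrow> real \<Rightarrow> real \<Rightarrow> real^4^4" where
  "wave_matrix w x y z = vector
     [vector [0, w, 0, 0], vector [w, 0, 0, 0], vector [0, 0, x, y], vector [0, 0, y, z]]"

text \<open>The Christoffel symbols of a plane wave are linear in eight functions of \<open>u\<close>, so that their
  derivative along \<open>u\<close> is given by the same array.\<close>

definition wave_christoffel ::
  "real \<Rightarrow> real \<Rightarrow> real \<Rightarrow> real \<Rightarrow> real \<Rightarrow> real \<Rightarrow> real \<Rightarrow> real \<Rightarrow> real^4^4^4" where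
  "wave_christoffel r x y z q11 q12 q21 q22 = vector
     [vector [vector [2 * r, 0, 0, 0], vector [0, 0, 0, 0], vector [0, 0, 0, 0], vector [0, 0, 0, 0]],
      vector [vector [0, 0, 0, 0], vector [0, 0, 0, 0], vector [0, 0, x / 2, y / 2], vector [0, 0, y / 2, z / 2]],
      vector [vector [0, 0, q11, q12], vector [0, 0, 0, 0], vector [q11, 0, 0, 0], vector [q12, 0, 0, 0]],
      vector [vector [0, 0, q21, q22], vector [0, 0, 0, 0], vector [q21, 0, 0, 0], vector [q22, 0, 0, 0]]]"

lemma matrix_inv_wave_matrix:
  assumes "w \<noteq> 0" "a * c - b * b = 1"
  shows "matrix_inv (wave_matrix w (- w * a) (- w * b) (- w * c))
    = wave_matrix (1 / w) (- c / w) (b / w) (- a / w)"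
proof (rule matrix_inv_eqI)
  have ac: "a * c = 1 + b * b" "c * a = 1 + b * b" using assms(2) by (auto simp: mult.commute)
  show "wave_matrix w (- w * a) (- w * b) (- w * c) ** wave_matrix (1 / w) (- c / w) (b / w) (- a / w) = mat 1"
    "wave_matrix (1 / w) (- c / w) (b / w) (- a / w) ** wave_matrix w (- w * a) (- w * b) (- w * c) = mat 1"
    using assms(1)
    by (simp_all add: vec_eq_iff forall_4 matrix_matrix_mult_def sum_4 mat_def wave_matrix_def vector_4 ac mult.commute)
qed

text \<open>The left side is the Ricci contraction for Christoffel symbols \<open>C\<close> that
  depend on the first coordinate alone, with derivative \<open>D\<close> in that direction.\<close>

lemma wave_ricci:
  fixes r x y z q11 q12 q21 q22 r' x' y' z' q11' q12' q21' q22'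
  defines "C \<equiv> wave_christoffel r x y z q11 q12 q21 q22"
    and "D \<equiv> wave_christoffel r' x' y' z' q11' q12' q21' q22'"
  shows "(\<Sum>i\<in>UNIV. (if i = 1 then D $ i $ l $ j else 0) - (if l = 1 then D $ i $ i $ j else 0)
     + (\<Sum>k\<in>UNIV. C $ i $ i $ k * C $ k $ l $ j - C $ i $ l $ k * C $ k $ i $ j))
     = (if j = 1 \<and> l = 1 then 2 * r' - (2 * r' + q11' + q22') + (2 * r + q11 + q22) * (2 * r)
        - (4 * r\<^sup>2 + q11\<^sup>2 + q22\<^sup>2 + 2 * (q12 * q21)) else 0)"
proof -
  have "l = 1 \<or> l = 2 \<or> l = 3 \<or> l = 4" "j = 1 \<or> j = 2 \<or> j = 3 \<or> j = 4" by (rule exhaust_4)+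
  then show ?thesis
    by (elim disjE; simp add: sum_4 C_def D_def wave_christoffel_def vector_4 algebra_simps power2_eq_square)
qed

text \<open>Let \<open>q\<close> be the 2x2 block of mixed Christoffel symbols. Its trace is
  \<open>2 r\<close>, and by Cayley-Hamilton the trace of its square is
  \<open>4 r^2 - 2 det q\<close>. The surviving Ricci component becomes
  \<open>2 (det q - r')\<close>, which the hypothesis on \<open>r\<close> makes zero.\<close>

lemma vacuum_wave:
  fixes V :: "real set" and G :: "real^4 \<Rightarrow> real^4^4" and a b c r w :: "real \<Rightarrow> real"
  assumes V: "is_interval V" "v \<in> V" "v' \<in> V" "v \<noteq> v'"
    and G: "\<And>p. p $ 1 \<in> V \<Longrightarrow>
      G p = wave_matrix (w (p $ 1)) (- w (p $ 1) * a (p $ 1)) (- w (p $ 1) * b (p $ 1)) (- w (p $ 1) * c (p $ 1))"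
    and w: "\<And>u. w u \<noteq> 0" "\<And>u. (w has_real_derivative 2 * r u * w u) (at u)"
    and a: "\<And>u. (a has_real_derivative a' u) (at u)" "\<And>u. (a' has_real_derivative a'' u) (at u)"
    and b: "\<And>u. (b has_real_derivative b' u) (at u)" "\<And>u. (b' has_real_derivative b'' u) (at u)"
    and c: "\<And>u. (c has_real_derivative c' u) (at u)" "\<And>u. (c' has_real_derivative c'' u) (at u)"
    and det: "\<And>u. a u * c u - b u * b u = 1"
    and r: "\<And>u. (r has_real_derivative (r u)\<^sup>2 - ((b' u)\<^sup>2 - a' u * c' u) / 4) (at u)"
  shows "vacuum {p. p $ 1 \<in> V} G"
proof -
  let ?M = "{p :: real^4. p $ 1 \<in> V}"
  note partial = partial_slab[OF V]
  define r' where "r' u = (r u)\<^sup>2 - ((b' u)\<^sup>2 - a' u * c' u) / 4" for u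
  have r': "(r has_real_derivative r' u) (at u)" for u using r by (simp add: r'_def)
  \<comment> \<open>These satisfy \<open>(w a)' = w x\<close>, and likewise for \<open>b\<close>,
    \<open>c\<close>. The block \<open>q\<close> below is half the inverse of the matrix of
    \<open>a\<close>, \<open>b\<close>, \<open>c\<close> times that of \<open>x\<close>,
    \<open>y\<close>, \<open>z\<close>.\<close>
  define x y z where "x u = 2 * r u * a u + a' u" and "y u = 2 * r u * b u + b' u"
    and "z u = 2 * r u * c u + c' u" for u
  define x' y' z' where "x' u = 2 * r' u * a u + 2 * r u * a' u + a'' u"
    and "y' u = 2 * r' u * b u + 2 * r u * b' u + b'' u"
    and "z' u = 2 * r' u * c u + 2 * r u * c' u + c'' u" for u
  have xyz: "(x has_real_derivative x' u) (at u)" "(y has_real_derivative y' u) (at u)"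
    "(z has_real_derivative z' u) (at u)" for u
    unfolding x_def[abs_def] y_def[abs_def] z_def[abs_def] x'_def y'_def z'_def
    by (auto intro!: derivative_eq_intros a b c r')
  define q11 q12 q21 q22 where "q11 u = (c u * x u - b u * y u) / 2"
    and "q12 u = (c u * y u - b u * z u) / 2" and "q21 u = (a u * y u - b u * x u) / 2"
    and "q22 u = (a u * z u - b u * y u) / 2" for u
  define q11' q12' q21' q22' where "q11' u = (c' u * x u + c u * x' u - b' u * y u - b u * y' u) / 2"
    and "q12' u = (c' u * y u + c u * y' u - b' u * z u - b u * z' u) / 2"
    and "q21' u = (a' u * y u + a u * y' u - b' u * x u - b u * x' u) / 2"
    and "q22' u = (a' u * z u + a u * z' u - b' u * y u - b u * y' u) / 2" for u
  have q: "(q11 has_real_derivative q11' u) (at u)" "(q12 has_real_derivative q12' u) (at u)"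
    "(q21 has_real_derivative q21' u) (at u)" "(q22 has_real_derivative q22' u) (at u)" for u
    unfolding q11_def[abs_def] q12_def[abs_def] q21_def[abs_def] q22_def[abs_def]
      q11'_def q12'_def q21'_def q22'_def
    by (auto intro!: derivative_eq_intros a b c xyz)
  have det': "c u * a' u - 2 * (b u * b' u) + a u * c' u = 0" for u
  proof -
    have "((\<lambda>u. a u * c u - b u * b u) has_real_derivative
        c u * a' u - 2 * (b u * b' u) + a u * c' u) (at u)"
      by (auto intro!: derivative_eq_intros a b c simp: algebra_simps)
    then show ?thesis unfolding det using DERIV_const DERIV_unique by blast
  qed
  have trace: "q11 u + q22 u = 2 * r u" for u
  proof -
    have "2 * (q11 u + q22 u) = 4 * r u * (a u * c u - b u * b u)
        + (c u * a' u - 2 * (b u * b' u) + a u * c' u)"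
      unfolding q11_def q22_def x_def y_def z_def by (simp add: field_simps)
    then show ?thesis unfolding det det' by simp
  qed
  have trace': "q11' u + q22' u = 2 * r' u" for u
  proof -
    have "((\<lambda>u. q11 u + q22 u) has_real_derivative q11' u + q22' u) (at u)"
      by (intro DERIV_add q)
    moreover have "((\<lambda>u. q11 u + q22 u) has_real_derivative 2 * r' u) (at u)"
      unfolding trace by (auto intro!: derivative_eq_intros r')
    ultimately show ?thesis by (rule DERIV_unique)
  qed
  \<comment> \<open>Expanding the determinant of \<open>2 r h + h'\<close>, the term linear in
    \<open>r\<close> vanishes because \<open>det h\<close> is constant.\<close>
  have det_q: "q11 u * q22 u - q12 u * q21 u = (r u)\<^sup>2 - ((b' u)\<^sup>2 - a' u * c' u) / 4" for u
  proof -
    have "4 * (q11 u * q22 u - q12 u * q21 u) = (a u * c u - b u * b u) * (x u * z u - y u * y u)"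
      unfolding q11_def q12_def q21_def q22_def by (simp add: field_simps)
    also have "x u * z u - y u * y u = 4 * (r u)\<^sup>2 * (a u * c u - b u * b u)
        + 2 * r u * (c u * a' u - 2 * (b u * b' u) + a u * c' u) - ((b' u)\<^sup>2 - a' u * c' u)"
      unfolding x_def y_def z_def by (simp add: algebra_simps power2_eq_square)
    finally have "4 * (q11 u * q22 u - q12 u * q21 u) = 4 * (r u)\<^sup>2 - ((b' u)\<^sup>2 - a' u * c' u)"
      by (simp only: det det' mult_1 mult_1_right mult_zero_right add_0_right)
    then show ?thesis by (simp add: field_simps)
  qed
  define \<Gamma> where "\<Gamma> u = wave_christoffel (r u) (x u) (y u) (z u) (q11 u) (q12 u) (q21 u) (q22 u)" for u
  define \<Gamma>' where "\<Gamma>' u = wave_christoffel (r' u) (x' u) (y' u) (z' u) (q11' u) (q12' u) (q21' u) (q22' u)" for u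
  have d\<Gamma>: "((\<lambda>u. \<Gamma> u $ k $ i $ j) has_real_derivative \<Gamma>' u $ k $ i $ j) (at u)" for k i j u
  proof -
    have "\<forall>k i j. ((\<lambda>u. \<Gamma> u $ k $ i $ j) has_real_derivative \<Gamma>' u $ k $ i $ j) (at u)"
      unfolding \<Gamma>_def \<Gamma>'_def wave_christoffel_def forall_4
      by (auto simp: vector_4 intro!: derivative_eq_intros r' xyz q)
    then show ?thesis by blast
  qed
  have dG: "partial ?M i (\<lambda>q. G q $ j $ l) p = (if i = 1 then
      wave_matrix (2 * r (p $ 1) * w (p $ 1)) (- w (p $ 1) * x (p $ 1)) (- w (p $ 1) * y (p $ 1))
        (- w (p $ 1) * z (p $ 1)) $ j $ l else 0)" if p: "p $ 1 \<in> V" for p i j l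
  proof (rule partial[OF p])
    show "G q $ j $ l = wave_matrix (w (q $ 1)) (- w (q $ 1) * a (q $ 1)) (- w (q $ 1) * b (q $ 1))
        (- w (q $ 1) * c (q $ 1)) $ j $ l" if "q $ 1 \<in> V" for q
      using G[OF that] by simp
    have "\<forall>j l. ((\<lambda>u. wave_matrix (w u) (- w u * a u) (- w u * b u) (- w u * c u) $ j $ l)
      has_real_derivative wave_matrix (2 * r u * w u) (- w u * x u) (- w u * y u) (- w u * z u) $ j $ l) (at u)" for u
      unfolding wave_matrix_def forall_4 x_def y_def z_def
      by (auto simp: vector_4 intro!: derivative_eq_intros w a b c) (auto simp: algebra_simps)
    then show "((\<lambda>u. wave_matrix (w u) (- w u * a u) (- w u * b u) (- w u * c u) $ j $ l)
      has_real_derivative wave_matrix (2 * r (p $ 1) * w (p $ 1)) (- w (p $ 1) * x (p $ 1)) (- w (p $ 1) * y (p $ 1))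
        (- w (p $ 1) * z (p $ 1)) $ j $ l) (at (p $ 1))" by blast
  qed
  have chr: "christoffel ?M G p k i j = \<Gamma> (p $ 1) $ k $ i $ j" if p: "p $ 1 \<in> V" for p k i j
  proof -
    define u where "u = p $ 1"
    have inv: "matrix_inv (G p) = wave_matrix (1 / w u) (- c u / w u) (b u / w u) (- a u / w u)"
      unfolding G[OF p] u_def by (rule matrix_inv_wave_matrix[OF w(1) det])
    have "\<forall>k i j. christoffel ?M G p k i j = \<Gamma> u $ k $ i $ j"
      unfolding christoffel_def inv dG[OF p] u_def[symmetric]
        \<Gamma>_def wave_christoffel_def wave_matrix_def forall_4 sum_4
      using w(1)[of u]
      by (simp add: vector_4 q11_def q12_def q21_def q22_def field_simps)
    then show ?thesis by (simp add: u_def)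
  qed
  have dchr: "partial ?M i (\<lambda>q. christoffel ?M G q k l j) p = (if i = 1 then \<Gamma>' (p $ 1) $ k $ l $ j else 0)"
    if p: "p $ 1 \<in> V" for p i j k l
    by (rule partial[OF p chr d\<Gamma>])
  have "ricci ?M G p j l = 0" if p: "p $ 1 \<in> V" for p j l
  proof -
    define u where "u = p $ 1"
    have zero: "2 * r' u - (2 * r' u + q11' u + q22' u) + (2 * r u + q11 u + q22 u) * (2 * r u)
        - (4 * (r u)\<^sup>2 + (q11 u)\<^sup>2 + (q22 u)\<^sup>2 + 2 * (q12 u * q21 u)) = 0"
    proof -
      have "(q11 u)\<^sup>2 + (q22 u)\<^sup>2 + 2 * (q12 u * q21 u) = (q11 u + q22 u)\<^sup>2 - 2 * (q11 u * q22 u - q12 u * q21 u)"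
        by (simp add: power2_eq_square algebra_simps)
      then have sq: "(q11 u)\<^sup>2 + (q22 u)\<^sup>2 + 2 * (q12 u * q21 u) = 4 * (r u)\<^sup>2 - 2 * r' u"
        unfolding trace det_q r'_def by (simp add: power2_eq_square)
      have "2 * r' u - (2 * r' u + (q11' u + q22' u)) + (2 * r u + (q11 u + q22 u)) * (2 * r u)
        - (4 * (r u)\<^sup>2 + ((q11 u)\<^sup>2 + (q22 u)\<^sup>2 + 2 * (q12 u * q21 u))) = 0"
        unfolding sq trace trace' by (simp add: power2_eq_square algebra_simps)
      then show ?thesis by (simp add: algebra_simps)
    qed
    show ?thesis
      unfolding ricci_def riemann_def chr[OF p] dchr[OF p] u_def[symmetric] \<Gamma>_def \<Gamma>'_def wave_ricci
      using zero by simp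
  qed
  then show ?thesis unfolding vacuum_def by blast
qed

section \<open>Vacuum plane waves from hyperbolic drawings\<close>

theorem theorem13:
  fixes g :: "real \<Rightarrow> real^2^2" and I :: "real set"
  assumes "hyperbolic_drawing g"
    and "is_interval I" and "interior I \<noteq> {}" and "bdd_below I"
  shows "\<exists>(V :: real set) (s :: real \<Rightarrow> real) (m :: real \<Rightarrow> real).
    is_interval V \<and>
    strict_mono_on V s \<and> (\<exists>t. homeomorphism V I s t) \<and> smooth_on V s \<and>
    smooth_on V (g \<circ> s) \<and>
    smooth_on V m \<and> (\<forall>u\<in>V. m u > 0) \<and>
    vacuum {p. p $ 1 \<in> V} (plane_wave (g \<circ> s) m)"
proof -
  obtain s s' :: "real \<Rightarrow> real" and Q where mono: "strict_mono s" and s_int: "\<And>n. s (of_int n) = of_int n"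
    and s': "\<And>u. (s has_vector_derivative s' u) (at u)" and s_flat: "smooth_flat \<int> s"
    and s'_flat: "smooth_flat \<int> s'" and s'_bound: "\<And>u. \<bar>s' u\<bar> \<le> Q"
    by (rule flat_reparameterization) blast
  define V where "V = s -` I"
  define h where "h = g \<circ> s"
  have contd: "continuous_on UNIV s"
    using has_vector_derivative_continuous_on_UNIV[of s, OF s'] .
  have "surj s"
  proof -
    have "\<exists>x. s x = y" for y
    proof -
      have "\<exists>x\<ge>of_int \<lfloor>y\<rfloor>. x \<le> of_int (\<lfloor>y\<rfloor> + 1) \<and> s x = y"
      proof (rule IVT')
        show "s (of_int \<lfloor>y\<rfloor>) \<le> y" "y \<le> s (of_int (\<lfloor>y\<rfloor> + 1))"
          unfolding s_int by linarith+
        show "continuous_on {of_int \<lfloor>y\<rfloor>..of_int (\<lfloor>y\<rfloor> + 1)} s"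
          using contd by (rule continuous_on_subset) simp
      qed simp
      then show ?thesis by blast
    qed
    then show ?thesis by (metis surj_def)
  qed
  obtain t where "homeomorphism UNIV (s ` UNIV) s t"
    using invariance_of_domain_homeomorphism[of UNIV s] contd strict_mono_imp_inj_on[OF mono] by auto
  then have homeo: "homeomorphism V I s t"
    by (rule homeomorphism_of_subsets[where T'' = UNIV]) (use \<open>surj s\<close> in \<open>auto simp: V_def\<close>)
  have V_int: "is_interval V"
  proof -
    have "x \<in> V" if "a \<in> V" "b \<in> V" "a \<le> x" "x \<le> b" for a b x
    proof -
      have "s a \<le> s x" "s x \<le> s b" using that mono by (simp_all add: strict_mono_less_eq)
      then show ?thesis using that \<open>is_interval I\<close> unfolding is_interval_1 V_def by blast
    qed
    then show ?thesis unfolding is_interval_1 by blast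
  qed
  \<comment> \<open>Two distinct points make \<open>V\<close> nondegenerate, so that derivatives
    within the slab are unique.\<close>
  obtain v v' where vv: "v \<in> V" "v' \<in> V" "v \<noteq> v'"
  proof -
    obtain x where "x \<in> interior I" using assms(3) by auto
    then obtain e where e: "e > 0" "cball x e \<subseteq> I" by (auto simp: mem_interior_cball)
    then have "x \<in> I" "x + e \<in> I" by (auto simp: dist_real_def subset_iff)
    moreover obtain v v' where "s v = x" "s v' = x + e" using \<open>surj s\<close> by (metis surj_def)
    ultimately show ?thesis
      using e(1) by (intro that[of v v']) (auto simp: V_def)
  qed
  have hyp: "h u \<in> hyperbolic_plane" for u
    using assms(1) unfolding hyperbolic_drawing_def h_def by auto
  have "\<exists>C. arc_length_param C \<and> smooth_flat {} C \<and> (\<forall>u\<in>{of_int n .. of_int n + 1}. g u = C u)" for n :: int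
  proof -
    obtain C where "arc_length_param C" "hyp_geodesic C \<or> (\<exists>h. horocycle h \<and> range C \<subseteq> h)"
      "\<forall>u\<in>{of_int n .. of_int n + 1}. g u = C u"
      using assms(1) unfolding hyperbolic_drawing_def by blast
    then show ?thesis using geodesic_smooth horocycle_smooth by blast
  qed
  then obtain C where C: "\<And>n :: int. arc_length_param (C n)" "\<And>n. smooth_flat {} (C n)"
    "\<And>n u. u \<in> {of_int n .. of_int n + 1} \<Longrightarrow> g u = C n u" by metis
  \<comment> \<open>Fixing \<open>n\<close> and \<open>n + 1\<close>, the increasing
    \<open>s\<close> maps this interval into itself, so the pieces of \<open>h\<close> still break
    only at integers.\<close>
  have h_piece: "h u = C n (s u)" if "u \<in> {of_int n .. of_int n + 1}" for n u
  proof -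
    have "s (of_int n) \<le> s u" "s u \<le> s (of_int (n + 1))"
      using that strict_mono_less_eq[OF mono] by auto
    then show ?thesis using C(3) s_int[of n] s_int[of "n + 1"] by (simp add: h_def)
  qed
  have h_flat: "smooth_flat \<int> h"
    by (rule smooth_flat_glue[OF _ h_piece]) (use smooth_flat_compose[OF s_flat C(2)] in simp)
  obtain h' where h': "\<And>u. (h has_vector_derivative h' u) (at u)" "smooth_flat \<int> h'"
    using h_flat by (rule smooth_flatE) blast
  obtain h'' where h'': "\<And>u. (h' has_vector_derivative h'' u) (at u)"
    using h'(2) by (rule smooth_flatE) blast
  \<comment> \<open>Comparing derivatives within the closed unit interval covers its integer
    endpoints too, where \<open>h\<close> is given by \<open>C n\<close> on one side only.\<close>
  have speed: "- det (h' u) = (s' u)\<^sup>2" for u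
  proof -
    define n where "n = \<lfloor>u\<rfloor>"
    have u: "u \<in> {of_int n .. of_int n + 1}" unfolding n_def by (simp add: less_imp_le)
    obtain c' where c': "\<And>t. (C n has_vector_derivative c' t) (at t)" "\<And>t. - det (c' t) = 1"
      using C(1)[of n] unfolding arc_length_param_def by blast
    have "h' u = s' u *\<^sub>R c' (s u)"
    proof (rule vector_derivative_unique_within_closed_interval)
      show "(h has_vector_derivative h' u) (at u within cbox (of_int n) (of_int n + 1))"
        using h'(1) by (rule has_vector_derivative_at_within)
      show "(h has_vector_derivative s' u *\<^sub>R c' (s u)) (at u within cbox (of_int n) (of_int n + 1))"
        by (rule has_vector_derivative_transform[OF _ _ has_vector_derivative_at_within[OF
            has_vector_derivative_compose[OF s' c'(1)]]])
          (use u h_piece in auto)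
    qed (use u in auto)
    then have "- det (h' u) = (s' u)\<^sup>2 * - det (c' (s u))"
      by (simp add: det_2 power2_eq_square algebra_simps)
    then show ?thesis using c'(2) by simp
  qed
  define q where "q u = (s' u)\<^sup>2 / 4" for u
  have "smooth_flat {} (\<lambda>u. (1 / 4) * (s' u * s' u))"
    by (intro smooth_flat_mult smooth_flat_const smooth_flat_mono[OF s'_flat]) auto
  then have q_smooth: "smooth_flat {} q"
    by (simp add: q_def[abs_def] power2_eq_square)
  then obtain q' where q': "\<And>u. (q has_vector_derivative q' u) (at u)"
    by (rule smooth_flatE) blast
  have q_cont: "continuous_on UNIV q"
    using has_vector_derivative_continuous_on_UNIV[of q, OF q'] .
  have q_nonneg: "0 \<le> q u" and q_le: "q u \<le> Q\<^sup>2 / 4" for u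
    using power_mono[OF s'_bound[of u], of 2] by (simp_all add: q_def)
  obtain m m' where m: "\<And>u. (m has_vector_derivative m' u) (at u)"
    "\<And>u. (m' has_vector_derivative q u * m u) (at u)" and m_ge: "\<And>u. m u \<ge> 1"
    by (rule linear_ode_solution_ge_1[OF q_cont q_nonneg q_le]) (rule that; assumption)
  have m_pos: "m u > 0" for u using m_ge[of u] by simp
  have m_smooth: "smooth_flat {} m"
    using smooth_flat_linear_ode[OF q_smooth m] .
  \<comment> \<open>With \<open>r = - m'/m\<close> the linear equation for \<open>m\<close> becomes
    the Riccati equation required of \<open>r\<close>; by \<open>speed\<close>, its source term is
    \<open>q\<close>.\<close>
  have "vacuum {p. p $ 1 \<in> V} (plane_wave h m)"
  proof (rule vacuum_wave[OF V_int vv, where r = "\<lambda>u. - m' u / m u"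
        and a' = "\<lambda>u. h' u $ 1 $ 1" and b' = "\<lambda>u. h' u $ 1 $ 2" and c' = "\<lambda>u. h' u $ 2 $ 2"])
    note entry = has_vector_derivative_entry[OF h'(1), folded has_real_derivative_iff_has_vector_derivative]
    note md = m[folded has_real_derivative_iff_has_vector_derivative]
    show "plane_wave h m p = wave_matrix (1 / (m (p $ 1))\<^sup>2) (- (1 / (m (p $ 1))\<^sup>2) * h (p $ 1) $ 1 $ 1)
        (- (1 / (m (p $ 1))\<^sup>2) * h (p $ 1) $ 1 $ 2) (- (1 / (m (p $ 1))\<^sup>2) * h (p $ 1) $ 2 $ 2)" for p
      using hyperbolic_planeD(1)[OF hyp] by (simp add: plane_wave_def wave_matrix_def Let_def)
    show "1 / (m u)\<^sup>2 \<noteq> 0" for u using m_pos[of u] by simp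
    show "((\<lambda>u. 1 / (m u)\<^sup>2) has_real_derivative 2 * (- m' u / m u) * (1 / (m u)\<^sup>2)) (at u)" for u
    proof -
      have ne: "m u \<noteq> 0" using m_pos[of u] by simp
      have "((\<lambda>u. 1 / (m u)\<^sup>2) has_real_derivative
          (0 * (m u)\<^sup>2 - 1 * (2 * (m' u * m u))) / ((m u)\<^sup>2 * (m u)\<^sup>2)) (at u)"
        using DERIV_divide[OF DERIV_const[of 1] DERIV_power[OF md(1), of 2], of u] ne by simp
      also have "(0 * (m u)\<^sup>2 - 1 * (2 * (m' u * m u))) / ((m u)\<^sup>2 * (m u)\<^sup>2)
          = 2 * (- m' u / m u) * (1 / (m u)\<^sup>2)"
        using ne by (simp add: field_simps power2_eq_square)
      finally show ?thesis .
    qed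
    show "h u $ 1 $ 1 * h u $ 2 $ 2 - h u $ 1 $ 2 * h u $ 1 $ 2 = 1" for u
      using hyperbolic_planeD(3)[OF hyp, of u] by (simp add: power2_eq_square)
    have "h' u $ 2 $ 1 = h' u $ 1 $ 2" for u
      using entry[of 2 1 u] entry[of 1 2 u] unfolding hyperbolic_planeD(1)[OF hyp] by (rule DERIV_unique)
    then have accel: "((h' u $ 1 $ 2)\<^sup>2 - h' u $ 1 $ 1 * h' u $ 2 $ 2) / 4 = q u" for u
      using speed[of u] by (simp add: det_2 power2_eq_square q_def)
    show "((\<lambda>u. - m' u / m u) has_real_derivative
        (- m' u / m u)\<^sup>2 - ((h' u $ 1 $ 2)\<^sup>2 - h' u $ 1 $ 1 * h' u $ 2 $ 2) / 4) (at u)" for u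
    proof -
      have ne: "m u \<noteq> 0" using m_pos[of u] by simp
      have "((\<lambda>u. - m' u / m u) has_real_derivative
          (- (q u * m u) * m u - (- m' u) * m' u) / (m u * m u)) (at u)"
        by (intro DERIV_divide DERIV_minus md ne)
      also have "(- (q u * m u) * m u - (- m' u) * m' u) / (m u * m u) = (- m' u / m u)\<^sup>2 - q u"
        using ne by (simp add: field_simps power2_eq_square)
      finally show ?thesis unfolding accel .
    qed
  qed (rule has_vector_derivative_entry[OF h'(1), folded has_real_derivative_iff_has_vector_derivative]
      has_vector_derivative_entry[OF h'', folded has_real_derivative_iff_has_vector_derivative])+
  then have vac: "vacuum {p. p $ 1 \<in> V} (plane_wave (g \<circ> s) m)" by (simp only: h_def)
  have mono_V: "strict_mono_on V s"
    using mono unfolding strict_mono_def strict_mono_on_def by blast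
  have h_smooth: "smooth_flat \<int> (g \<circ> s)" using h_flat by (simp only: h_def)
  show ?thesis
  proof (rule exI[of _ V], rule exI[of _ s], rule exI[of _ m], intro conjI ballI)
    show "\<exists>t. homeomorphism V I s t" using homeo by blast
  qed (rule V_int mono_V smooth_flat_imp_smooth_on[OF s_flat] smooth_flat_imp_smooth_on[OF h_smooth]
      smooth_flat_imp_smooth_on[OF m_smooth] m_pos vac)+
qed

end
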